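(* Let $\mathbb{F}\in\{\mathbb{R},\mathbb{C}\}$, and let $r\geq 1$ and $n\geq 3$ be integers. (a) For matrices $(B_i)_{i=1}^{n-1}$ in $\mathbb{F}^{r\times r}$, the following are equivalent: (1) each $B_i$ is unitary and $B_i^*B_j+B_j^*B_i=-\tfrac{2}{n-2}I$ for all distinct $i,j\in\{1,\dots,n-1\}$; (2) $(B_i)_{i=1}^{n-1}$ is a simplex in some $\rho$-space in $\mathbb{F}^{r\times r}$; (3) there exists a $\rho$-orthonormal sequence $(C_i)_{i=1}^{n-2}$ in $\mathbb{F}^{r\times r}$ such that $$B_j=\sum_{i=1}^{n-2}\Psi_{n-1}(i,j)\,C_i\quad\text{for all } j\in\{1,\dots,n-1\}.$$ (b) An $\mathrm{EITFF}_{\mathbb{F}}(2r,r,n)$ exists if and only if $n\leq\rho_{\mathbb{F}}(r)+2$, where, writing $r=(2a+1)2^{4b+c}$ with nonnegative integers $a,b,c$ and $c\leq 3$, $$\rho_{\mathbb{R}}(r)=8b+2^c,\qquad \rho_{\mathbb{C}}(r)=8b+2c+2.$$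
   Context: For $\mathbb{F}=\mathbb{R}$, "unitary" means orthogonal; $^*$ denotes the adjoint (conjugate transpose). EITFFs. Let $(\mathcal{U}_i)_{i=1}^n$, $n\geq 2$, be $r$-dimensional subspaces of a $d$-dimensional Hilbert space $\mathcal{E}$ over $\mathbb{F}$, with orthogonal projections $\Pi_i$. The sequence is an $\mathrm{EITFF}_{\mathbb{F}}(d,r,n)$ (equi-isoclinic tight fusion frame) if it is equi-isoclinic, meaning there is $\sigma\geq0$ with $\Pi_i\Pi_j\Pi_i=\sigma^2\Pi_i$ for all $i\neq j$, and is a tight fusion frame for $\mathcal{E}$, meaning $\sum_{i=1}^n\Pi_i=aI$ for some $a>0$. Radon–Hurwitz notions. Regard $\mathbb{F}^{r\times r}$ as a real vector space. A scaled unitary is a scalar multiple of a unitary matrix. A $\rho$-space in $\mathbb{F}^{r\times r}$ is a real subspace all of whose members are scaled unitaries; it is a real inner product space under $\langle A,B\rangle_\rho:=\tfrac1r\mathrm{Re}(\mathrm{Tr}(A^*B))$. A sequence $(C_i)_{i=1}^m$ in $\mathbb{F}^{r\times r}$ is $\rho$-orthonormal if each $C_i$ is unitary and $C_i^*C_j+C_j^*C_i=0$ for all $i\neq j$. The Radon–Hurwitz number $\rho_{\mathbb{F}}(r)$ is the maximum real dimension of a $\rho$-space in $\mathbb{F}^{r\times r}$ (equivalently, the maximum length of a $\rho$-orthonormal sequence); its value is given, by classical results of Radon, Hurwitz, Adams and others, by the formula in the claim. Simplices. A sequence $(\varphi_i)_{i=1}^m$ of $m\geq2$ unit vectors in a real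 inner product space is a simplex if $\langle\varphi_i,\varphi_j\rangle=-\tfrac{1}{m-1}$ for all $i\neq j$. The $(m-1)\times m$ real matrices $\Psi_m$ are defined recursively by $\Psi_2:=\begin{bmatrix}1&-1\end{bmatrix}$ and $$\Psi_m:=\frac{1}{m-1}\begin{bmatrix}m-1&-\mathbf{1}^{\top}\\ \mathbf{0}&\sqrt{m(m-2)}\,\Psi_{m-1}\end{bmatrix},\quad m\geq3,$$ where $\mathbf{1}$ is the all-ones vector in $\mathbb{R}^{m-1}$ and $\mathbf{0}$ is the zero vector in $\mathbb{R}^{m-2}$. *)

theory Defs
  imports "HOL-Analysis.Analysis"
begin

text \<open>
  The class only serves to write each definition once for both fields; all statements are made at
  the types \<^typ>\<open>real\<close> and \<^typ>\<open>complex\<close>. An \<open>r \<times> r\<close> matrix over \<open>'a\<close> has type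
  \<open>'a^'r^'r\<close> with \<open>CARD('r) = r\<close>, and sequences are functions on \<^typ>\<open>nat\<close> indexed from 1.
\<close>

class real_or_complex = real_normed_field + euclidean_space +
  fixes conjg :: "'a \<Rightarrow> 'a" and re :: "'a \<Rightarrow> real"
  assumes conjg_add: "conjg (x + y) = conjg x + conjg y"
    and conjg_mult: "conjg (x * y) = conjg x * conjg y"
    and conjg_conjg: "conjg (conjg x) = x"
    and conjg_scaleR_one: "conjg (t *\<^sub>R 1) = t *\<^sub>R 1"
    and conjg_mult_self: "conjg x * x = (norm x)\<^sup>2 *\<^sub>R 1"
    and add_conjg: "x + conjg x = (2 * re x) *\<^sub>R 1"

instantiation real :: real_or_complex
begin

definition conjg_real :: "real \<Rightarrow> real" where "conjg_real x = x"

definition re_real :: "real \<Rightarrow> real" where "re_real x = x"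

instance
  by standard (auto simp: conjg_real_def re_real_def power2_eq_square)

end

instantiation complex :: real_or_complex
begin

definition conjg_complex :: "complex \<Rightarrow> complex" where "conjg_complex z = cnj z"

definition re_complex :: "complex \<Rightarrow> real" where "re_complex z = Re z"

instance
proof
  fix x :: complex
  show "conjg x * x = (norm x)\<^sup>2 *\<^sub>R 1"
    unfolding conjg_complex_def using complex_norm_square[of x] by (simp add: mult.commute scaleR_conv_of_real)
qed (auto simp: conjg_complex_def re_complex_def complex_eq_iff)

end

subsection \<open>Unitary matrices and Radon--Hurwitz notions\<close>

definition adj :: "'a::real_or_complex^'c^'r \<Rightarrow> 'a^'r^'c" where
  "adj A = (\<chi> i j. conjg (A $ j $ i))"

definition unitary :: "'a::real_or_complex^'r^'r \<Rightarrow> bool" where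
  "unitary A \<longleftrightarrow> adj A ** A = mat 1 \<and> A ** adj A = mat 1"

definition scaled_unitary :: "'a::real_or_complex^'r^'r \<Rightarrow> bool" where
  "scaled_unitary A \<longleftrightarrow> (\<exists>c Q. unitary Q \<and> A = (\<chi> i j. c * Q $ i $ j))"

text \<open>Here \<^const>\<open>subspace\<close>, and \<^const>\<open>dim\<close> below, refer to the real vector space structure,
  also for complex matrices.\<close>

definition rho_space :: "('a::real_or_complex^'r^'r) set \<Rightarrow> bool" where
  "rho_space S \<longleftrightarrow> subspace S \<and> (\<forall>A\<in>S. scaled_unitary A)"

definition rho_inner :: "'a::real_or_complex^'r^'r \<Rightarrow> 'a^'r^'r \<Rightarrow> real" where
  "rho_inner A B = 1 / real CARD('r) * re (trace (adj A ** B))"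

definition rho_orthonormal :: "nat \<Rightarrow> (nat \<Rightarrow> 'a::real_or_complex^'r^'r) \<Rightarrow> bool" where
  "rho_orthonormal m C \<longleftrightarrow>
     (\<forall>i\<in>{1..m}. unitary (C i)) \<and>
     (\<forall>i\<in>{1..m}. \<forall>j\<in>{1..m}. i \<noteq> j \<longrightarrow> adj (C i) ** C j + adj (C j) ** C i = 0)"

text \<open>The set below is finite and contains 0, because every dimension is at most that of the full
  matrix space.\<close>

definition radon_hurwitz :: "'a::real_or_complex itself \<Rightarrow> 'r::finite itself \<Rightarrow> nat" where
  "radon_hurwitz _ _ = Max {dim S | S :: ('a^'r^'r) set. rho_space S}"

subsection \<open>Simplices\<close>

definition simplex_in :: "'v set \<Rightarrow> ('v \<Rightarrow> 'v \<Rightarrow> real) \<Rightarrow> nat \<Rightarrow> (nat \<Rightarrow> 'v) \<Rightarrow> bool" where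
  "simplex_in V ip m \<phi> \<longleftrightarrow>
     m \<ge> 2 \<and>
     (\<forall>i\<in>{1..m}. \<phi> i \<in> V \<and> ip (\<phi> i) (\<phi> i) = 1) \<and>
     (\<forall>i\<in>{1..m}. \<forall>j\<in>{1..m}. i \<noteq> j \<longrightarrow> ip (\<phi> i) (\<phi> j) = - 1 / (real m - 1))"

text \<open>\<open>Psi m i j\<close> is the entry of \<open>\<Psi>\<^sub>m\<close> in row \<open>i \<in> {1..m-1}\<close> and column \<open>j \<in> {1..m}\<close>, for
  \<open>m \<ge> 2\<close>; other values are irrelevant.\<close>

fun Psi :: "nat \<Rightarrow> nat \<Rightarrow> nat \<Rightarrow> real" where
  "Psi m i j =
     (if m \<le> 2 then (if j = 1 then 1 else - 1)
      else 1 / (real m - 1) *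
        (if i = 1 then (if j = 1 then real m - 1 else - 1)
         else if j = 1 then 0
         else sqrt (real m * (real m - 2)) * Psi (m - 1) (i - 1) (j - 1)))"

declare Psi.simps [simp del]

subsection \<open>Equi-isoclinic tight fusion frames\<close>

definition hinner :: "'a::real_or_complex^'d \<Rightarrow> 'a^'d \<Rightarrow> 'a" where
  "hinner x y = (\<Sum>i\<in>UNIV. conjg (x $ i) * y $ i)"

definition is_orth_proj :: "('a::real_or_complex^'d) set \<Rightarrow> 'a^'d^'d \<Rightarrow> bool" where
  "is_orth_proj U P \<longleftrightarrow> (\<forall>x. P *v x \<in> U \<and> (\<forall>u\<in>U. hinner u (x - P *v x) = 0))"

text \<open>The ambient Hilbert space is \<open>'a^'d\<close>, which is the \<open>d\<close>-dimensional one up to unitary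
  equivalence, with \<open>d = CARD('d)\<close>. In contrast to the above, \<^const>\<open>vec.subspace\<close> and
  \<^const>\<open>vec.dim\<close> refer to the vector space structure over \<open>'a\<close> itself. The projections exist and
  are unique, so the quantifier over \<open>P\<close> makes no choice.\<close>

definition eitff :: "nat \<Rightarrow> nat \<Rightarrow> (nat \<Rightarrow> ('a::real_or_complex^'d) set) \<Rightarrow> bool" where
  "eitff r n U \<longleftrightarrow>
     n \<ge> 2 \<and>
     (\<forall>i\<in>{1..n}. vec.subspace (U i) \<and> vec.dim (U i) = r) \<and>
     (\<exists>P. (\<forall>i\<in>{1..n}. is_orth_proj (U i) (P i)) \<and>
       (\<exists>\<sigma>\<ge>0. \<forall>i\<in>{1..n}. \<forall>j\<in>{1..n}. i \<noteq> j \<longrightarrow> P i ** P j ** P i = \<sigma>\<^sup>2 *\<^sub>R P i) \<and>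
       (\<exists>a>0. (\<Sum>i\<in>{1..n}. P i) = a *\<^sub>R mat 1))"

end

theory Submission
  imports Defs
begin

text \<open>
  On a \<open>\<rho>\<close>-space the form \<open>A\<^sup>* B + B\<^sup>* A\<close> is \<open>2 \<langle>A, B\<rangle>\<^sub>\<rho> I\<close> by polarisation, so part (a) is linear
  algebra with the Gram matrices of the columns and rows of \<open>\<Psi>\<close>; conversely
  \<open>C\<^sub>i = (m - 1) / m \<Sum>\<^sub>j \<Psi>\<^sub>m(i,j) B\<^sub>j\<close> for \<open>m = n - 1\<close>. From a simplex one obtains a frame from the isometries
  \<open>e\<close> and \<open>\<alpha> e + \<beta> f B\<^sub>i\<close>, where \<open>e\<close>, \<open>f\<close> embed two orthogonal copies of \<open>\<F>\<^sup>r\<close>, with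
  \<open>\<alpha>\<^sup>2 = (n - 2) / (2 (n - 1)) = 1 - \<beta>\<^sup>2\<close>. Every frame has this shape after the choice of an isometry
  onto the last subspace, since the parameters are forced by traces.

  A \<open>\<rho>\<close>-orthonormal sequence of length \<open>k + 1\<close> amounts to \<open>k\<close> anticommuting skew complex structures. An
  involution that anticommutes with an invertible map has a fixed space of half the dimension. Eight
  complex structures yield four commuting involutions of this kind, over the complex numbers already
  two yield one, and the remaining structures act on the common fixed space, which bounds \<open>k\<close>. The bound is attained by anticommuting Pauli strings.
\<close>

subsection \<open>Adjoints\<close>

text \<open>Rank r in dimension 2r makes the frame problem one about square matrices: the complement
  of one subspace also has dimension r, so every other subspace of the frame is recorded by an r x r
  unitary. Compressing the tightness equation to one subspace gives 1 + (n - 1) \<sigma>^2 = n / 2,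
  the source of \<alpha>. Isoclinism of two further subspaces then only constrains
  \<open>X + adj X\<close> for the unitary \<open>X = adj (B i) ** B j\<close>, and with these
  parameters the constraint is the simplex relation.

  Dimensions of Clifford modules are counted over the reals for both fields; multiplication by the
  imaginary unit is an extra complex structure that commutes with the others. One matrix too many
  yields k = 8b + 2^c structures over the reals and k = 2(4b + c) + 2 over the complex numbers, and
  the divisor so obtained is twice the exact power of 2 in the real dimension. In the construction
  the strings use up the power of 2 in r; the odd factor counts equal diagonal blocks.\<close>

lemma conjg_zero [simp]: "conjg (0::'a::real_or_complex) = 0"
  using conjg_scaleR_one[of 0] by simp

lemma conjg_one [simp]: "conjg (1::'a::real_or_complex) = 1"
  using conjg_scaleR_one[of 1] by simp

lemma conjg_scaleR: "conjg (t *\<^sub>R x) = t *\<^sub>R conjg (x::'a::real_or_complex)"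
proof -
  have "conjg (t *\<^sub>R x) = conjg ((t *\<^sub>R 1) * x)" by simp
  also have "\<dots> = t *\<^sub>R conjg x" by (simp only: conjg_mult conjg_scaleR_one) simp
  finally show ?thesis .
qed

lemma conjg_minus: "conjg (- x) = - conjg (x::'a::real_or_complex)"
  using conjg_scaleR[of "-1" x] by simp

lemma conjg_sum: "conjg (sum f S) = (\<Sum>i\<in>S. conjg (f i :: 'a::real_or_complex))"
  by (induction S rule: infinite_finite_induct) (auto simp: conjg_add)

text \<open>The class determines \<open>re\<close> only through \<open>add_conjg\<close>, so every
  value of \<open>re\<close> is computed by exhibiting \<open>x + conjg x\<close> as a real multiple
  of 1.\<close>

lemma re_unique:
  assumes "x + conjg x = (2 * t) *\<^sub>R (1::'a::real_or_complex)" shows "re x = t"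
  using assms add_conjg[of x] by (simp del: scaleR_scaleR)

lemma re_add: "re (x + y) = re x + re (y::'a::real_or_complex)"
proof (rule re_unique)
  have "(x + y) + conjg (x + y) = (x + conjg x) + (y + conjg y)"
    by (simp add: conjg_add algebra_simps)
  then show "(x + y) + conjg (x + y) = (2 * (re x + re y)) *\<^sub>R 1"
    by (simp add: add_conjg algebra_simps)
qed

lemma re_scaleR: "re (t *\<^sub>R x) = t * re (x::'a::real_or_complex)"
proof (rule re_unique)
  have "t *\<^sub>R x + conjg (t *\<^sub>R x) = t *\<^sub>R (x + conjg x)"
    by (simp add: conjg_scaleR algebra_simps)
  then show "t *\<^sub>R x + conjg (t *\<^sub>R x) = (2 * (t * re x)) *\<^sub>R 1"
    by (simp add: add_conjg mult_ac)
qed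

lemma re_zero [simp]: "re (0::'a::real_or_complex) = 0"
  using re_scaleR[of 0 "0::'a"] by simp

lemma re_one [simp]: "re (1::'a::real_or_complex) = 1"
  by (rule re_unique) (simp add: scaleR_2)

lemma re_sum: "re (sum f S) = (\<Sum>i\<in>S. re (f i :: 'a::real_or_complex))"
  by (induction S rule: infinite_finite_induct) (auto simp: re_add)

text \<open>Polarisation of \<open>conjg_mult_self\<close>. It links conjugation to the Euclidean
  inner product of the field; the class axioms relate the two only through the norm.\<close>

lemma re_conjg_mult: "re (conjg x * y) = inner x (y::'a::real_or_complex)"
proof (rule re_unique)
  have "conjg (x + y) * (x + y) = conjg x * x + conjg y * y + (conjg x * y + conjg y * x)"
    by (simp add: conjg_add algebra_simps)
  then have "conjg x * y + conjg y * x =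
      ((norm (x + y))\<^sup>2 - (norm x)\<^sup>2 - (norm y)\<^sup>2) *\<^sub>R 1"
    unfolding conjg_mult_self scaleR_diff_left by simp
  also have "(norm (x + y))\<^sup>2 - (norm x)\<^sup>2 - (norm y)\<^sup>2 = 2 * inner x y"
    by (simp add: power2_norm_eq_inner inner_add inner_commute)
  finally show "conjg x * y + conjg (conjg x * y) = (2 * inner x y) *\<^sub>R 1"
    by (simp add: conjg_mult conjg_conjg mult.commute)
qed

section \<open>Adjoints, matrix products and traces\<close>

lemma adj_adj [simp]: "adj (adj A) = A"
  by (simp add: adj_def vec_eq_iff conjg_conjg)

lemma adj_add: "adj (A + B) = adj A + adj B"
  by (simp add: adj_def vec_eq_iff conjg_add)

lemma adj_scaleR: "adj (t *\<^sub>R A) = t *\<^sub>R adj A"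
  by (simp add: adj_def vec_eq_iff conjg_scaleR)

lemma adj_minus: "adj (- A) = - adj A"
  by (simp add: adj_def vec_eq_iff conjg_minus)

lemma adj_diff: "adj (A - B) = adj A - adj B"
  using adj_add[of A "- B"] by (simp add: adj_minus)

lemma adj_zero [simp]: "adj 0 = 0"
  by (simp add: adj_def vec_eq_iff)

lemma adj_sum: "adj (sum f S) = (\<Sum>i\<in>S. adj (f i))"
  by (induction S rule: infinite_finite_induct) (auto simp: adj_add)

lemma adj_mat_1 [simp]: "adj (mat 1) = mat 1"
  by (simp add: adj_def vec_eq_iff mat_def)

lemma adj_mult: "adj (A ** B) = adj B ** adj A"
  by (simp add: adj_def vec_eq_iff matrix_matrix_mult_def conjg_sum conjg_mult mult.commute)

lemma matrix_add_left: "(A + B) ** C = A ** C + B ** (C :: 'a::semiring_1^'n^'m)"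
  by (simp add: vec_eq_iff matrix_matrix_mult_def distrib_right sum.distrib)

lemma matrix_scaleR_left: "(t *\<^sub>R A) ** B = t *\<^sub>R (A ** (B :: 'a::real_algebra_1^'n^'m))"
  by (simp add: vec_eq_iff matrix_matrix_mult_def scaleR_sum_right)

lemma matrix_scaleR_right: "A ** (t *\<^sub>R B) = t *\<^sub>R (A ** (B :: 'a::real_algebra_1^'n^'m))"
  by (simp add: vec_eq_iff matrix_matrix_mult_def scaleR_sum_right)

lemma matrix_minus_left: "(- A) ** B = - (A ** (B :: 'a::real_algebra_1^'n^'m))"
  using matrix_scaleR_left[of "-1"] by simp

lemma matrix_minus_right: "A ** (- B) = - (A ** (B :: 'a::real_algebra_1^'n^'m))"
  using matrix_scaleR_right[of _ "-1"] by simp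

lemma matrix_diff_left: "(A - B) ** C = A ** C - B ** (C :: 'a::real_algebra_1^'n^'m)"
  using matrix_add_left[of A "- B" C] by (simp add: matrix_minus_left)

lemma matrix_diff_right: "C ** (A - B) = C ** A - C ** (B :: 'a::real_algebra_1^'n^'m)"
  using matrix_add_ldistrib[of C A "- B"] by (simp add: matrix_minus_right)

lemma matrix_sum_left: "sum f S ** B = (\<Sum>i\<in>S. f i ** (B :: 'a::real_algebra_1^'n^'m))"
  by (induction S rule: infinite_finite_induct) (auto simp: matrix_add_left)

lemma matrix_sum_right: "B ** sum f S = (\<Sum>i\<in>S. B ** (f i :: 'a::real_algebra_1^'n^'m))"
  by (induction S rule: infinite_finite_induct) (auto simp: matrix_add_ldistrib)

lemmas matrix_distribs = matrix_scaleR_left matrix_scaleR_right matrix_minus_left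
  matrix_minus_right matrix_diff_left matrix_diff_right matrix_add_left matrix_add_ldistrib

lemmas adj_distribs = adj_add adj_diff adj_scaleR adj_minus adj_mult

lemma trace_scaleR: "trace (t *\<^sub>R (A :: 'a::real_algebra_1^'n^'n)) = t *\<^sub>R trace A"
  by (simp add: trace_def scaleR_sum_right)

lemma re_trace_mat_1: "re (trace (mat 1 :: 'a::real_or_complex^'n^'n)) = real CARD('n)"
  using re_scaleR[of "real CARD('n)" "1::'a"]
  by (simp add: trace_def mat_def scaleR_conv_of_real)

text \<open>The trace form is the Euclidean inner product of matrices. Thus \<open>rho_inner\<close>
  is that inner product divided by r, and real orthogonality and dimension theory apply to
  it.\<close>

lemma re_trace_adj_mult: "re (trace (adj A ** B)) = inner A B"
proof -
  have "re (trace (adj A ** B)) = (\<Sum>i\<in>UNIV. \<Sum>k\<in>UNIV. inner (A $ k $ i) (B $ k $ i))"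
    by (simp add: trace_def adj_def matrix_matrix_mult_def re_sum re_conjg_mult)
  also have "\<dots> = inner A B"
    unfolding inner_vec_def by (rule sum.swap)
  finally show ?thesis .
qed

lemma adj_mult_self_eq_0: "adj A ** A = 0 \<Longrightarrow> A = 0"
  using re_trace_adj_mult[of A A] by (simp add: trace_def)

lemma rho_inner_inner:
  "rho_inner A B = inner A (B :: 'a::real_or_complex^'r^'r) / real CARD('r)"
  by (simp add: rho_inner_def re_trace_adj_mult)

lemma unitaryI: "adj A ** A = mat 1 \<Longrightarrow> unitary A"
  by (simp add: unitary_def matrix_left_right_inverse)

lemma hinner_adj: "hinner (A *v x) y = hinner x (adj A *v y)"
proof -
  have "hinner (A *v x) y = (\<Sum>i\<in>UNIV. \<Sum>j\<in>UNIV. conjg (A $ i $ j) * conjg (x $ j) * y $ i)"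
    by (simp add: hinner_def matrix_vector_mult_def conjg_sum conjg_mult sum_distrib_right)
  also have "\<dots> = (\<Sum>j\<in>UNIV. \<Sum>i\<in>UNIV. conjg (A $ i $ j) * conjg (x $ j) * y $ i)"
    by (rule sum.swap)
  also have "\<dots> = hinner x (adj A *v y)"
    by (simp add: hinner_def matrix_vector_mult_def adj_def sum_distrib_left mult_ac)
  finally show ?thesis .
qed

lemma re_hinner: "re (hinner x y) = inner x y"
  by (simp add: hinner_def re_sum re_conjg_mult inner_vec_def)

lemma inner_adj: "inner (A *v x) y = inner x (adj A *v (y :: 'a::real_or_complex^'m))"
  by (simp add: hinner_adj flip: re_hinner)

subsection \<open>\<open>\<rho>\<close>-spaces\<close>

text \<open>Taking real parts of traces identifies the scalar, so afterwards it suffices to know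
  that an anticommutator is some real multiple of the identity.\<close>

lemma anticommutator_scalar:
  fixes A B :: "'a::real_or_complex^'r^'r"
  assumes "adj A ** B + adj B ** A = t *\<^sub>R mat 1"
  shows "t = 2 * rho_inner A B"
proof -
  have "inner A B + inner B A = re (trace (adj A ** B + adj B ** A))"
    by (simp only: trace_add re_add re_trace_adj_mult)
  also have "\<dots> = t * real CARD('r)"
    by (simp only: assms trace_scaleR re_scaleR re_trace_mat_1)
  finally show ?thesis
    by (simp add: rho_inner_inner inner_commute field_simps)
qed

text \<open>A quadratic equation replaces the choice of a scalar and a unitary, and only this form
  can be polarised. A nonzero scalar \<open>t\<close> equals the mean square of the column norms,
  hence is positive, and dividing by \<open>sqrt t\<close> gives the unitary.\<close>

lemma scaled_unitary_iff:
  fixes A :: "'a::real_or_complex^'r^'r"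
  shows "scaled_unitary A \<longleftrightarrow> (\<exists>t. adj A ** A = t *\<^sub>R mat 1)"
proof
  assume "scaled_unitary A"
  then obtain c Q where Q: "unitary Q" "A = (\<chi> i j. c * Q $ i $ j)"
    by (auto simp: scaled_unitary_def)
  have "adj A ** A = (norm c)\<^sup>2 *\<^sub>R (adj Q ** Q)"
  proof -
    have "(adj A ** A) $ i $ j = (norm c)\<^sup>2 *\<^sub>R (adj Q ** Q) $ i $ j" for i j
    proof -
      have "(adj A ** A) $ i $ j = (conjg c * c) * (adj Q ** Q) $ i $ j"
        by (simp add: Q(2) adj_def matrix_matrix_mult_def conjg_mult sum_distrib_left mult_ac)
      then show ?thesis by (simp add: conjg_mult_self)
    qed
    then show ?thesis by (simp add: vec_eq_iff)
  qed
  then show "\<exists>t. adj A ** A = t *\<^sub>R mat 1"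
    using Q(1) by (auto simp: unitary_def)
next
  assume "\<exists>t. adj A ** A = t *\<^sub>R mat 1"
  then obtain t where t: "adj A ** A = t *\<^sub>R mat 1" by blast
  have tr: "inner A A = t * real CARD('r)"
    using re_trace_adj_mult[of A A] by (simp only: t trace_scaleR re_scaleR re_trace_mat_1)
  have "t \<ge> 0"
    using inner_ge_zero[of A] by (simp add: tr zero_le_mult_iff)
  show "scaled_unitary A"
  proof (cases "t = 0")
    case True
    then have "A = (\<chi> i j. 0 * mat 1 $ i $ j)"
      using tr by (simp add: vec_eq_iff)
    moreover have "unitary (mat 1 :: 'a^'r^'r)" by (simp add: unitary_def)
    ultimately show ?thesis unfolding scaled_unitary_def by blast
  next
    case False
    define Q where "Q = (1 / sqrt t) *\<^sub>R A"
    have "unitary Q"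
      using \<open>t \<ge> 0\<close> False
      by (intro unitaryI) (simp add: Q_def adj_scaleR matrix_distribs t)
    moreover have "A = (\<chi> i j. of_real (sqrt t) * Q $ i $ j)"
      using \<open>t \<ge> 0\<close> False by (simp add: Q_def vec_eq_iff flip: scaleR_conv_of_real)
    ultimately show ?thesis unfolding scaled_unitary_def by blast
  qed
qed

lemma rho_space_anticommutator:
  fixes A B :: "'a::real_or_complex^'r^'r"
  assumes "rho_space S" "A \<in> S" "B \<in> S"
  shows "adj A ** B + adj B ** A = (2 * rho_inner A B) *\<^sub>R mat 1"
proof -
  have "A + B \<in> S" using assms by (simp add: rho_space_def subspace_add)
  then obtain s t u where "adj A ** A = s *\<^sub>R mat 1" "adj B ** B = t *\<^sub>R mat 1"
    "adj (A + B) ** (A + B) = u *\<^sub>R mat 1"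
    using assms by (metis rho_space_def scaled_unitary_iff)
  then have "adj A ** B + adj B ** A = (u - s - t) *\<^sub>R mat 1"
    by (simp add: adj_add matrix_distribs algebra_simps)
  then show ?thesis using anticommutator_scalar by metis
qed

text \<open>For fixed \<open>B\<close>, the matrices whose anticommutator with \<open>B\<close> is
  scalar form a real subspace. Minimality of the span is applied in one argument and then in the
  other; the diagonal case gives scaled unitaries.\<close>

lemma rho_space_span:
  fixes F :: "('a::real_or_complex^'r^'r) set"
  assumes "\<And>A B. A \<in> F \<Longrightarrow> B \<in> F \<Longrightarrow> \<exists>t. adj A ** B + adj B ** A = t *\<^sub>R mat 1"
  shows "rho_space (span F)"
proof -
  have sub: "subspace {A. \<exists>t. adj A ** B + adj B ** A = t *\<^sub>R mat 1}" for B :: "'a^'r^'r"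
  proof (rule subspaceI)
    show "0 \<in> {A. \<exists>t. adj A ** B + adj B ** A = t *\<^sub>R mat 1}"
      by (auto intro!: exI[of _ 0])
  next
    fix X Y assume "X \<in> {A. \<exists>t. adj A ** B + adj B ** A = t *\<^sub>R mat 1}"
      "Y \<in> {A. \<exists>t. adj A ** B + adj B ** A = t *\<^sub>R mat 1}"
    then obtain s t where st: "adj X ** B + adj B ** X = s *\<^sub>R mat 1"
      "adj Y ** B + adj B ** Y = t *\<^sub>R mat 1" by blast
    have "adj (X + Y) ** B + adj B ** (X + Y) =
        (adj X ** B + adj B ** X) + (adj Y ** B + adj B ** Y)"
      by (simp add: adj_add matrix_distribs)
    also have "\<dots> = (s + t) *\<^sub>R mat 1" by (simp add: st scaleR_add_left)
    finally show "X + Y \<in> {A. \<exists>t. adj A ** B + adj B ** A = t *\<^sub>R mat 1}" by blast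
  next
    fix c X assume "X \<in> {A. \<exists>t. adj A ** B + adj B ** A = t *\<^sub>R mat 1}"
    then obtain t where t: "adj X ** B + adj B ** X = t *\<^sub>R mat 1" by blast
    have "adj (c *\<^sub>R X) ** B + adj B ** (c *\<^sub>R X) = c *\<^sub>R (adj X ** B + adj B ** X)"
      by (simp add: adj_scaleR matrix_distribs scaleR_add_right)
    also have "\<dots> = (c * t) *\<^sub>R mat 1" by (simp add: t)
    finally show "c *\<^sub>R X \<in> {A. \<exists>t. adj A ** B + adj B ** A = t *\<^sub>R mat 1}" by blast
  qed
  have 1: "\<exists>t. adj A ** B + adj B ** A = t *\<^sub>R mat 1" if "A \<in> span F" "B \<in> F" for A B
    using span_minimal[OF _ sub[of B], of F] assms that by blast
  have 2: "\<exists>t. adj A ** B + adj B ** A = t *\<^sub>R mat 1" if "A \<in> span F" "B \<in> span F" for A B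
  proof -
    have "F \<subseteq> {B. \<exists>t. adj B ** A + adj A ** B = t *\<^sub>R mat 1}"
      using 1[OF that(1)] by (auto simp: add.commute)
    from span_minimal[OF this sub[of A]] that(2) show ?thesis by (auto simp: add.commute)
  qed
  have "scaled_unitary A" if A: "A \<in> span F" for A
  proof -
    obtain t where "adj A ** A + adj A ** A = t *\<^sub>R mat 1" using 2[OF A A] by blast
    then have "2 *\<^sub>R (adj A ** A) = t *\<^sub>R mat 1" by (simp add: scaleR_2)
    then have "(1/2) *\<^sub>R 2 *\<^sub>R (adj A ** A) = (1/2) *\<^sub>R t *\<^sub>R mat 1" by (simp only:)
    then have "adj A ** A = (t / 2) *\<^sub>R mat 1" by simp
    then show ?thesis unfolding scaled_unitary_iff by blast
  qed
  then show ?thesis by (simp add: rho_space_def)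
qed

lemma rho_inner_unitary:
  fixes A :: "'a::real_or_complex^'r^'r"
  assumes "unitary A" shows "rho_inner A A = 1"
  using assms by (simp add: rho_inner_def unitary_def re_trace_mat_1)

text \<open>The matrices are nonzero and orthogonal for the trace form, hence independent over the
  reals.\<close>

lemma rho_orthonormal_rho_space:
  fixes C :: "nat \<Rightarrow> 'a::real_or_complex^'r^'r"
  assumes "rho_orthonormal m C"
  shows "rho_space (span (C ` {1..m}))" "dim (span (C ` {1..m})) = m"
proof -
  have C: "unitary (C i)" "i \<noteq> j \<Longrightarrow> adj (C i) ** C j + adj (C j) ** C i = 0"
    if "i \<in> {1..m}" "j \<in> {1..m}" for i j
    using assms that by (auto simp: rho_orthonormal_def)
  have "\<exists>t. adj (C i) ** C j + adj (C j) ** C i = t *\<^sub>R mat 1"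
    if "i \<in> {1..m}" "j \<in> {1..m}" for i j
  proof (cases "i = j")
    case True
    have "adj (C i) ** C i + adj (C i) ** C i = 2 *\<^sub>R mat 1"
      using C(1)[OF that] by (simp add: unitary_def scaleR_2)
    then show ?thesis using True by blast
  next
    case False
    then show ?thesis using C(2)[OF that] by (auto intro!: exI[of _ 0])
  qed
  then show "rho_space (span (C ` {1..m}))"
    by (intro rho_space_span) blast
  have self: "inner (C i) (C i) = real CARD('r)" if "i \<in> {1..m}" for i
    using rho_inner_unitary[OF C(1)[OF that that]] by (simp add: rho_inner_inner field_simps)
  have orth: "inner (C i) (C j) = 0" if "i \<in> {1..m}" "j \<in> {1..m}" "i \<noteq> j" for i j
    using anticommutator_scalar[of "C i" "C j" 0] C(2)[OF that] by (simp add: rho_inner_inner)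
  have inj: "inj_on C {1..m}"
  proof (rule inj_onI, rule ccontr)
    fix i j assume "i \<in> {1..m}" "j \<in> {1..m}" "C i = C j" "i \<noteq> j"
    then show False using orth[of i j] self[of i] by auto
  qed
  have "pairwise orthogonal (C ` {1..m})"
    by (rule pairwiseI) (auto simp: orthogonal_def intro!: orth)
  moreover have "0 \<notin> C ` {1..m}"
  proof
    assume "0 \<in> C ` {1..m}"
    then obtain i where "i \<in> {1..m}" "C i = 0" by auto
    then show False using self[of i] by auto
  qed
  ultimately have "independent (C ` {1..m})"
    by (rule pairwise_orthogonal_independent)
  then show "dim (span (C ` {1..m})) = m"
    using inj by (simp add: dim_eq_card_independent card_image)
qed

lemma rho_space_rho_orthonormal:
  fixes S :: "('a::real_or_complex^'r^'r) set"
  assumes "rho_space S" "m \<le> dim S"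
  shows "\<exists>C :: nat \<Rightarrow> 'a^'r^'r. rho_orthonormal m C"
proof -
  obtain B where B: "B \<subseteq> S" "pairwise orthogonal B" "\<And>x. x \<in> B \<Longrightarrow> norm x = 1"
    "independent B" "card B = dim S"
    using orthonormal_basis_subspace assms(1) unfolding rho_space_def by metis
  then have "finite B" by (simp add: independent_imp_finite)
  then obtain g where "bij_betw g {1..dim S} B"
    using ex_bij_betw_nat_finite_1 B(5) by metis
  then have g: "\<And>i. i \<in> {1..m} \<Longrightarrow> g i \<in> B" and inj: "inj_on g {1..m}"
    using assms(2) by (auto simp: bij_betw_def intro: inj_on_subset)
  \<comment> \<open>Vectors orthonormal for \<open>inner\<close> have squared length 1/r for
    \<open>rho_inner\<close>; the factor compensates.\<close>
  define C where "C i = sqrt (real CARD('r)) *\<^sub>R g i" for i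
  have CS: "C i \<in> S" if "i \<in> {1..m}" for i
    using g[OF that] B(1) assms(1) by (auto simp: C_def rho_space_def subspace_scale)
  have ip: "rho_inner (C i) (C j) = inner (g i) (g j)" for i j
    by (simp add: rho_inner_inner C_def flip: mult.assoc)
  have "unitary (C i)" if "i \<in> {1..m}" for i
  proof -
    have "rho_inner (C i) (C i) = 1"
      using B(3)[OF g[OF that]] by (simp add: ip norm_eq_1)
    then have "2 *\<^sub>R (adj (C i) ** C i) = 2 *\<^sub>R mat 1"
      using rho_space_anticommutator[OF assms(1) CS[OF that] CS[OF that]] by (simp add: scaleR_2)
    then show ?thesis by (intro unitaryI) simp
  qed
  moreover have "adj (C i) ** C j + adj (C j) ** C i = 0"
    if "i \<in> {1..m}" "j \<in> {1..m}" "i \<noteq> j" for i j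
  proof -
    have "g i \<noteq> g j" using inj that by (auto dest: inj_onD)
    then have "inner (g i) (g j) = 0"
      using B(2) g that by (auto simp: pairwise_def orthogonal_def)
    then show ?thesis
      using rho_space_anticommutator[OF assms(1) CS CS] that by (simp add: ip)
  qed
  ultimately show ?thesis unfolding rho_orthonormal_def by blast
qed

text \<open>Bounds on the Radon-Hurwitz number are from here on statements about the existence of
  sequences; the maximum and the subspaces do not occur again.\<close>

lemma le_radon_hurwitz_iff:
  "m \<le> radon_hurwitz TYPE('a::real_or_complex) TYPE('r::finite) \<longleftrightarrow>
    (\<exists>C :: nat \<Rightarrow> 'a^'r^'r. rho_orthonormal m C)"
proof -
  let ?D = "{dim S | S :: ('a^'r^'r) set. rho_space S}"
  have "rho_space {0 :: 'a^'r^'r}"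
    using rho_space_span[of "{} :: ('a^'r^'r) set"] by simp
  then have ne: "?D \<noteq> {}" by blast
  have "?D \<subseteq> {..DIM('a^'r^'r)}" using dim_subset_UNIV by blast
  then have fin: "finite ?D" by (rule finite_subset) simp
  have "m \<le> Max ?D \<longleftrightarrow> (\<exists>d\<in>?D. m \<le> d)" by (rule Max_ge_iff[OF fin ne])
  also have "\<dots> \<longleftrightarrow> (\<exists>C :: nat \<Rightarrow> 'a^'r^'r. rho_orthonormal m C)"
  proof
    assume "\<exists>d\<in>?D. m \<le> d"
    then show "\<exists>C :: nat \<Rightarrow> 'a^'r^'r. rho_orthonormal m C"
      using rho_space_rho_orthonormal by blast
  next
    assume "\<exists>C :: nat \<Rightarrow> 'a^'r^'r. rho_orthonormal m C"
    then obtain C :: "nat \<Rightarrow> 'a^'r^'r" where "rho_orthonormal m C" by blast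
    note C = rho_orthonormal_rho_space[OF this]
    show "\<exists>d\<in>?D. m \<le> d"
      by (rule bexI[of _ m]) (use C in \<open>auto intro!: exI[of _ "span (C ` {1..m})"]\<close>)
  qed
  finally show ?thesis by (simp add: radon_hurwitz_def)
qed

subsection \<open>Simplices\<close>

lemma sum_from_1_Suc: "(\<Sum>j=1..Suc m. f j) = f 1 + (\<Sum>j=1..m. f (Suc j))"
  by (simp add: sum.atLeast_Suc_atMost sum.atLeast_Suc_atMost_Suc_shift del: sum.cl_ivl_Suc)

lemma Psi_2: "Psi 2 i j = (if j = 1 then 1 else - 1)"
  by (subst Psi.simps) simp

context
  fixes m :: nat
  assumes m: "2 \<le> m"
begin

text \<open>The factor in front of the block \<open>Psi m\<close> inside \<open>Psi (Suc m)\<close>: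
  \<open>sqrt (M * (M - 2)) / (M - 1)\<close> at \<open>M = m + 1\<close>.\<close>

definition Psi_scale :: real where
  "Psi_scale = sqrt ((real m + 1) * (real m - 1)) / real m"

lemma Psi_scale_mult: "Psi_scale * Psi_scale = (real m + 1) * (real m - 1) / (real m * real m)"
  using m by (simp add: Psi_scale_def)

lemma Psi_Suc:
  "Psi (Suc m) 1 1 = 1"
  "1 \<le> j \<Longrightarrow> Psi (Suc m) 1 (Suc j) = - 1 / real m"
  "1 \<le> i \<Longrightarrow> Psi (Suc m) (Suc i) 1 = 0"
  "1 \<le> i \<Longrightarrow> 1 \<le> j \<Longrightarrow> Psi (Suc m) (Suc i) (Suc j) = Psi_scale * Psi m i j"
  using m by (subst Psi.simps; simp add: Psi_scale_def add_ac)+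

end

lemma Psi_row_sum:
  assumes "2 \<le> m" "i \<in> {1..m-1}"
  shows "(\<Sum>j=1..m. Psi m i j) = 0"
  using assms
proof (induction m arbitrary: i rule: nat_induct_at_least)
  case base
  then show ?case by (simp add: Psi_2[unfolded numeral_2_eq_2] numeral_2_eq_2)
next
  case (Suc m)
  note P = Psi_Suc[OF Suc.hyps]
  show ?case
  proof (cases "i = 1")
    case True
    then show ?thesis unfolding sum_from_1_Suc
      using P Suc.hyps by simp
  next
    case False
    then obtain l where l: "i = Suc l" "l \<in> {1..m-1}"
      using Suc.prems by (cases i) auto
    then show ?thesis unfolding sum_from_1_Suc
      using P Suc.IH[OF l(2)] by (simp flip: sum_distrib_left)
  qed
qed

text \<open>The rows are orthogonal and of equal length, so a multiple of the transpose is a right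
  inverse of Psi. The first row is constant after its first entry, and its product with a later row
  vanishes because that row of the smaller block sums to zero.\<close>

lemma Psi_row_gram:
  assumes "2 \<le> m" "i \<in> {1..m-1}" "k \<in> {1..m-1}"
  shows "(\<Sum>j=1..m. Psi m i j * Psi m k j) = (if i = k then real m / (real m - 1) else 0)"
  using assms
proof (induction m arbitrary: i k rule: nat_induct_at_least)
  case base
  then show ?case by (simp add: Psi_2[unfolded numeral_2_eq_2] numeral_2_eq_2)
next
  case (Suc m)
  note P = Psi_Suc[OF Suc.hyps]
  have pos: "real m > 1" using Suc.hyps by simp
  have mixed: "(\<Sum>j=1..Suc m. Psi (Suc m) 1 j * Psi (Suc m) (Suc l) j) = 0"
    if "l \<in> {1..m-1}" for l
  proof -
    have "(\<Sum>j=1..Suc m. Psi (Suc m) 1 j * Psi (Suc m) (Suc l) j) =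
        (\<Sum>j=1..m. (- Psi_scale m / real m) * Psi m l j)"
      unfolding sum_from_1_Suc using P that by (simp add: mult_ac)
    also have "\<dots> = 0"
      unfolding sum_distrib_left[symmetric] using Psi_row_sum[OF Suc.hyps that] by simp
    finally show ?thesis .
  qed
  consider "i = 1" "k = 1" | l where "i = 1" "k = Suc l" "l \<in> {1..m-1}"
    | l where "k = 1" "i = Suc l" "l \<in> {1..m-1}"
    | l l' where "i = Suc l" "l \<in> {1..m-1}" "k = Suc l'" "l' \<in> {1..m-1}"
    using Suc.prems by (cases i; cases k; cases "i = 1"; cases "k = 1") auto
  then show ?case
  proof cases
    case 1
    have "(\<Sum>j=1..m. Psi (Suc m) 1 (Suc j) * Psi (Suc m) 1 (Suc j)) = (\<Sum>j=1..m. 1 / (real m * real m))"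
      using P by (intro sum.cong refl) auto
    then show ?thesis unfolding sum_from_1_Suc using 1 P(1) pos by (simp add: field_simps)
  next
    case 2
    then show ?thesis using mixed[of l] by simp
  next
    case 3
    then show ?thesis using mixed[of l] by (simp add: mult.commute)
  next
    case 4
    have "(\<Sum>j=1..Suc m. Psi (Suc m) i j * Psi (Suc m) k j) =
        (\<Sum>j=1..m. (Psi_scale m * Psi_scale m) * (Psi m l j * Psi m l' j))"
      unfolding sum_from_1_Suc using P 4 by (simp add: mult_ac)
    also have "\<dots> = (Psi_scale m * Psi_scale m) * (\<Sum>j=1..m. Psi m l j * Psi m l' j)"
      by (rule sum_distrib_left[symmetric])
    also have "\<dots> = (if i = k then real (Suc m) / (real (Suc m) - 1) else 0)"
      using Suc.IH[OF 4(2,4)] 4(1,3) pos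
      by (simp add: Psi_scale_mult[OF Suc.hyps] divide_simps)
    finally show ?thesis .
  qed
qed

text \<open>The columns form a simplex. Two later columns share the first coordinate -1/m, which
  contributes 1/m^2, and the scaled smaller simplex supplies the rest: 1/m^2 - (m + 1)/m^2 = -1/m
  off the diagonal.\<close>

lemma Psi_column_gram:
  assumes "2 \<le> m" "j \<in> {1..m}" "k \<in> {1..m}"
  shows "(\<Sum>i=1..m-1. Psi m i j * Psi m i k) = (if j = k then 1 else - 1 / (real m - 1))"
  using assms
proof (induction m arbitrary: j k rule: nat_induct_at_least)
  case base
  then show ?case by (auto simp: Psi_2[unfolded numeral_2_eq_2] numeral_2_eq_2)
next
  case (Suc m)
  note P = Psi_Suc[OF Suc.hyps]
  have pos: "real m > 1" using Suc.hyps by simp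
  have split: "(\<Sum>i=1..Suc m - 1. Psi (Suc m) i j * Psi (Suc m) i k) =
    Psi (Suc m) 1 j * Psi (Suc m) 1 k +
    (\<Sum>i=1..m-1. Psi (Suc m) (Suc i) j * Psi (Suc m) (Suc i) k)"
    using sum_from_1_Suc[of "\<lambda>i. Psi (Suc m) i j * Psi (Suc m) i k" "m - 1"] Suc.hyps by simp
  consider "j = 1" "k = 1" | l where "j = 1" "k = Suc l" "l \<in> {1..m}"
    | l where "k = 1" "j = Suc l" "l \<in> {1..m}"
    | l l' where "j = Suc l" "l \<in> {1..m}" "k = Suc l'" "l' \<in> {1..m}"
    using Suc.prems by (cases j; cases k; cases "j = 1"; cases "k = 1") auto
  then show ?case
  proof cases
    case 4
    have "(\<Sum>i=1..m-1. Psi (Suc m) (Suc i) j * Psi (Suc m) (Suc i) k) =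
        (\<Sum>i=1..m-1. (Psi_scale m * Psi_scale m) * (Psi m i l * Psi m i l'))"
      using P 4 by (simp add: mult_ac)
    also have "\<dots> = (Psi_scale m * Psi_scale m) * (\<Sum>i=1..m-1. Psi m i l * Psi m i l')"
      by (rule sum_distrib_left[symmetric])
    also have "\<dots> = (Psi_scale m * Psi_scale m) * (if l = l' then 1 else - 1 / (real m - 1))"
      by (simp only: Suc.IH[OF 4(2,4)])
    finally have rest: "(\<Sum>i=1..m-1. Psi (Suc m) (Suc i) j * Psi (Suc m) (Suc i) k) = \<dots>" .
    have "Psi (Suc m) 1 j * Psi (Suc m) 1 k = 1 / (real m * real m)"
      using P 4 by simp
    then show ?thesis
      unfolding split rest Psi_scale_mult[OF Suc.hyps] using 4(1,3) pos
      by (simp add: divide_simps) (simp add: algebra_simps)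
  qed (use P pos in \<open>unfold split, simp_all\<close>)
qed

text \<open>Each row of the Gram matrix sums to 1 - (m - 1)/(m - 1) = 0, so the sum of the vectors
  is orthogonal to each of them and therefore to itself.\<close>

lemma sum_simplex_eq_0:
  fixes B :: "nat \<Rightarrow> 'a::real_or_complex^'r^'r"
  assumes "m \<ge> 2"
    and ip: "\<And>i j. i \<in> {1..m} \<Longrightarrow> j \<in> {1..m} \<Longrightarrow>
      rho_inner (B i) (B j) = (if i = j then 1 else - 1 / (real m - 1))"
  shows "(\<Sum>i=1..m. B i) = 0"
proof -
  have "(\<Sum>j=1..m. inner (B j) (B i)) = 0" if "i \<in> {1..m}" for i
  proof -
    have "(\<Sum>j=1..m. inner (B i) (B j)) / real CARD('r) = (\<Sum>j=1..m. rho_inner (B i) (B j))"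
      by (simp add: rho_inner_inner sum_divide_distrib)
    also have "\<dots> = (\<Sum>j=1..m. (if i = j then 1 + 1 / (real m - 1) else 0) + - 1 / (real m - 1))"
      by (intro sum.cong refl) (use ip that in auto)
    also have "\<dots> = 0"
      using that \<open>m \<ge> 2\<close> by (simp add: sum_subtractf) (simp add: field_simps)
    finally show ?thesis by (simp add: inner_commute)
  qed
  then have "inner (\<Sum>i=1..m. B i) (\<Sum>i=1..m. B i) = 0"
    unfolding inner_sum_left inner_sum_right by simp
  then show ?thesis by simp
qed

text \<open>If a family has scalar anticommutators with Gram matrix \<open>g\<close>, real
  combinations of it do too, and their Gram matrix is the bilinear image of \<open>g\<close>. Both
  directions between \<open>B\<close> and \<open>C\<close> rest on this.\<close>

lemma anticommutator_sum_scaleR: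
  fixes X :: "nat \<Rightarrow> 'a::real_or_complex^'r^'r"
  assumes "finite I" and X: "\<And>i j. i \<in> I \<Longrightarrow> j \<in> I \<Longrightarrow>
      adj (X i) ** X j + adj (X j) ** X i = (2 * g i j) *\<^sub>R mat 1"
  shows "adj (\<Sum>i\<in>I. a i *\<^sub>R X i) ** (\<Sum>j\<in>I. b j *\<^sub>R X j) +
      adj (\<Sum>j\<in>I. b j *\<^sub>R X j) ** (\<Sum>i\<in>I. a i *\<^sub>R X i) =
      (2 * (\<Sum>i\<in>I. \<Sum>j\<in>I. a i * b j * g i j)) *\<^sub>R mat 1"
proof -
  have "adj (\<Sum>i\<in>I. a i *\<^sub>R X i) ** (\<Sum>j\<in>I. b j *\<^sub>R X j) =
      (\<Sum>i\<in>I. \<Sum>j\<in>I. (a i * b j) *\<^sub>R (adj (X i) ** X j))"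
    by (simp only: adj_sum adj_scaleR matrix_sum_left)
      (simp add: matrix_sum_right matrix_distribs scaleR_sum_right mult.commute)
  moreover have "adj (\<Sum>j\<in>I. b j *\<^sub>R X j) ** (\<Sum>i\<in>I. a i *\<^sub>R X i) =
      (\<Sum>j\<in>I. \<Sum>i\<in>I. (a i * b j) *\<^sub>R (adj (X j) ** X i))"
    by (simp only: adj_sum adj_scaleR matrix_sum_left)
      (simp add: matrix_sum_right matrix_distribs scaleR_sum_right mult.commute)
  moreover have "\<dots> = (\<Sum>i\<in>I. \<Sum>j\<in>I. (a i * b j) *\<^sub>R (adj (X j) ** X i))"
    by (rule sum.swap)
  ultimately have "adj (\<Sum>i\<in>I. a i *\<^sub>R X i) ** (\<Sum>j\<in>I. b j *\<^sub>R X j) +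
      adj (\<Sum>j\<in>I. b j *\<^sub>R X j) ** (\<Sum>i\<in>I. a i *\<^sub>R X i) =
      (\<Sum>i\<in>I. \<Sum>j\<in>I. (a i * b j) *\<^sub>R (adj (X i) ** X j + adj (X j) ** X i))"
    by (simp add: sum.distrib scaleR_add_right)
  also have "\<dots> = (\<Sum>i\<in>I. \<Sum>j\<in>I. (2 * (a i * b j * g i j)) *\<^sub>R mat 1)"
    by (intro sum.cong refl) (simp add: X)
  also have "\<dots> = (2 * (\<Sum>i\<in>I. \<Sum>j\<in>I. a i * b j * g i j)) *\<^sub>R mat 1"
    by (simp only: scaleR_sum_left sum_distrib_left)
  finally show ?thesis .
qed

lemma rho_orthonormal_anticommutator:
  fixes C :: "nat \<Rightarrow> 'a::real_or_complex^'r^'r"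
  shows "rho_orthonormal m C \<longleftrightarrow> (\<forall>i\<in>{1..m}. \<forall>j\<in>{1..m}.
    adj (C i) ** C j + adj (C j) ** C i = (2 * (if i = j then 1 else 0)) *\<^sub>R mat 1)"
    (is "_ \<longleftrightarrow> ?R")
proof
  assume "rho_orthonormal m C"
  then show ?R by (auto simp: rho_orthonormal_def unitary_def scaleR_2)
next
  assume R: ?R
  have "unitary (C i)" if "i \<in> {1..m}" for i
  proof -
    have "2 *\<^sub>R (adj (C i) ** C i) = 2 *\<^sub>R mat 1"
      using R[rule_format, OF that that] by (simp add: scaleR_2)
    then show ?thesis by (intro unitaryI) simp
  qed
  then show "rho_orthonormal m C" using R by (auto simp: rho_orthonormal_def)
qed

text \<open>All conditions are compared with \<open>H\<close>, which prescribes every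
  anticommutator, the diagonal ones included, by the Gram matrix \<open>G\<close> of a simplex. The
  only direction that needs an inversion is from \<open>H\<close> to the sequence \<open>C\<close>:
  there the rank deficiency of the square matrix \<open>G\<close> has to be absorbed by the
  vanishing sum of the \<open>B j\<close>.\<close>

lemma simplex_iff:
  fixes B :: "nat \<Rightarrow> 'a::real_or_complex^'r^'r"
  assumes n: "n \<ge> 3"
  shows "((\<forall>i\<in>{1..n-1}. unitary (B i)) \<and>
         (\<forall>i\<in>{1..n-1}. \<forall>j\<in>{1..n-1}. i \<noteq> j \<longrightarrow>
            adj (B i) ** B j + adj (B j) ** B i = (- 2 / (real n - 2)) *\<^sub>R mat 1))
        \<longleftrightarrow> (\<exists>S. rho_space S \<and> simplex_in S rho_inner (n - 1) B)" (is "?L \<longleftrightarrow> ?M")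
    and "(\<exists>S. rho_space S \<and> simplex_in S rho_inner (n - 1) B)
        \<longleftrightarrow> (\<exists>C. rho_orthonormal (n - 2) C \<and>
              (\<forall>j\<in>{1..n-1}. B j = (\<Sum>i\<in>{1..n-2}. Psi (n - 1) i j *\<^sub>R C i)))" (is "_ \<longleftrightarrow> ?R")
proof -
  define m where "m = n - 1"
  have m: "m \<ge> 2" and n1: "n - 1 = m" and n2: "n - 2 = m - 1" and rn: "real n - 2 = real m - 1"
    using n by (auto simp: m_def)
  have pos: "real m > 1" using m by simp
  define G where "G i j = (if i = j then 1 else - 1 / (real m - 1))" for i j :: nat
  define H where "H = (\<forall>i\<in>{1..m}. \<forall>j\<in>{1..m}.
    adj (B i) ** B j + adj (B j) ** B i = (2 * G i j) *\<^sub>R mat 1)"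
  have LH: "?L \<longleftrightarrow> H"
  proof
    assume ?L
    then show H unfolding H_def G_def n1 rn by (auto simp: unitary_def scaleR_2)
  next
    assume h: H
    have "unitary (B i)" if "i \<in> {1..m}" for i
    proof -
      have "2 *\<^sub>R (adj (B i) ** B i) = 2 *\<^sub>R mat 1"
        using h[unfolded H_def, rule_format, OF that that] by (simp add: scaleR_2 G_def)
      then show ?thesis by (intro unitaryI) simp
    qed
    then show ?L using h unfolding H_def G_def n1 rn by auto
  qed
  have HM: "?M" if h: H
  proof -
    have sp: "rho_space (span (B ` {1..m}))"
      using h by (intro rho_space_span) (auto simp: H_def)
    have "rho_inner (B i) (B j) = G i j" if "i \<in> {1..m}" "j \<in> {1..m}" for i j
      using h that anticommutator_scalar[of "B i" "B j" "2 * G i j"] by (simp add: H_def)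
    then have "simplex_in (span (B ` {1..m})) rho_inner m B"
      using m by (auto simp: simplex_in_def G_def intro: span_base)
    then show ?thesis using sp n1 by auto
  qed
  have MH: H if M: ?M
  proof -
    obtain S where S: "rho_space S" "simplex_in S rho_inner m B" using M n1 by auto
    then show ?thesis
      unfolding H_def by (auto simp: simplex_in_def rho_space_anticommutator[OF S(1)] G_def)
  qed
  show "?L \<longleftrightarrow> ?M" using LH HM MH by blast
  have RH: H if R: ?R
  proof -
    obtain C where C: "rho_orthonormal (m - 1) C"
      and BC: "\<And>j. j \<in> {1..m} \<Longrightarrow> B j = (\<Sum>i\<in>{1..m-1}. Psi m i j *\<^sub>R C i)"
      using R n1 n2 by auto
    show ?thesis unfolding H_def
    proof (intro ballI)
      fix j k assume jk: "j \<in> {1..m}" "k \<in> {1..m}"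
      have "adj (B j) ** B k + adj (B k) ** B j =
          (2 * (\<Sum>i\<in>{1..m-1}. \<Sum>l\<in>{1..m-1}. Psi m i j * Psi m l k *
            (if i = l then 1 else 0))) *\<^sub>R mat 1"
        unfolding BC[OF jk(1)] BC[OF jk(2)]
        by (rule anticommutator_sum_scaleR) (use C in \<open>auto simp: rho_orthonormal_anticommutator\<close>)
      also have "(\<Sum>i\<in>{1..m-1}. \<Sum>l\<in>{1..m-1}. Psi m i j * Psi m l k * (if i = l then 1 else 0)) =
          (\<Sum>i\<in>{1..m-1}. Psi m i j * Psi m i k)"
        by (simp add: if_distrib[of "(*) _"] sum.delta cong: if_cong)
      also have "\<dots> = G j k"
        using Psi_column_gram[OF m jk] by (simp add: G_def)
      finally show "adj (B j) ** B k + adj (B k) ** B j = (2 * G j k) *\<^sub>R mat 1" .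
    qed
  qed
  have HR: ?R if h: H
  proof -
    have "rho_inner (B i) (B j) = G i j" if "i \<in> {1..m}" "j \<in> {1..m}" for i j
      using h that anticommutator_scalar[of "B i" "B j" "2 * G i j"] by (simp add: H_def)
    then have sumB: "(\<Sum>i=1..m. B i) = 0"
      by (intro sum_simplex_eq_0[OF m]) (auto simp: G_def)
    define c where "c = (real m - 1) / real m"
    define C where "C i = (\<Sum>j=1..m. (c * Psi m i j) *\<^sub>R B j)" for i
    have "B j = (\<Sum>i\<in>{1..m-1}. Psi m i j *\<^sub>R C i)" if j: "j \<in> {1..m}" for j
    proof -
      have "(\<Sum>i\<in>{1..m-1}. Psi m i j *\<^sub>R C i) =
          (\<Sum>i\<in>{1..m-1}. \<Sum>k=1..m. (c * (Psi m i j * Psi m i k)) *\<^sub>R B k)"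
        by (simp add: C_def scaleR_sum_right mult_ac)
      also have "\<dots> = (\<Sum>k=1..m. \<Sum>i\<in>{1..m-1}. (c * (Psi m i j * Psi m i k)) *\<^sub>R B k)"
        by (rule sum.swap)
      also have "\<dots> = (\<Sum>k=1..m. (c * G j k) *\<^sub>R B k)"
        using Psi_column_gram[OF m j]
        by (intro sum.cong refl) (simp add: G_def flip: scaleR_sum_left sum_distrib_left)
      \<comment> \<open>The matrix \<open>c * G\<close> is the identity minus 1/m times the all-ones
        matrix; the second part is killed by \<open>sumB\<close>.\<close>
      also have "\<dots> = (\<Sum>k=1..m. (if j = k then B k else 0) - (1 / real m) *\<^sub>R B k)"
      proof (intro sum.cong refl)
        fix k
        have "c * G j k = (if j = k then 1 else 0) - 1 / real m"
          using pos by (auto simp: c_def G_def divide_simps)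
        then show "(c * G j k) *\<^sub>R B k = (if j = k then B k else 0) - (1 / real m) *\<^sub>R B k"
          by (auto simp: scaleR_diff_left)
      qed
      also have "\<dots> = B j"
        using j sumB by (simp add: sum_subtractf sum.delta flip: scaleR_sum_right)
      finally show ?thesis by simp
    qed
    moreover have "rho_orthonormal (m - 1) C"
      unfolding rho_orthonormal_anticommutator
    proof (intro ballI)
      fix i l assume il: "i \<in> {1..m-1}" "l \<in> {1..m-1}"
      have "adj (C i) ** C l + adj (C l) ** C i =
          (2 * (\<Sum>j=1..m. \<Sum>k=1..m. c * Psi m i j * (c * Psi m l k) * G j k)) *\<^sub>R mat 1"
        unfolding C_def by (rule anticommutator_sum_scaleR) (use h in \<open>auto simp: H_def\<close>)
      \<comment> \<open>The same projection \<open>c * G\<close> appears; its all-ones part now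
        disappears because the rows of Psi sum to zero.\<close>
      also have "(\<Sum>j=1..m. \<Sum>k=1..m. c * Psi m i j * (c * Psi m l k) * G j k) =
          (\<Sum>j=1..m. c * (Psi m i j * Psi m l j))"
      proof (intro sum.cong refl)
        fix j assume j: "j \<in> {1..m}"
        have "(\<Sum>k=1..m. c * Psi m i j * (c * Psi m l k) * G j k) =
            (\<Sum>k=1..m. c * Psi m i j * ((if j = k then Psi m l k else 0) - 1 / real m * Psi m l k))"
        proof (intro sum.cong refl)
          fix k
          have cG: "c * G j k = (if j = k then 1 else 0) - 1 / real m"
            using pos by (auto simp: c_def G_def divide_simps)
          have "c * Psi m i j * Psi m l k * (c * G j k) =
            c * Psi m i j * ((if j = k then Psi m l k else 0) - 1 / real m * Psi m l k)"
            by (simp only: cG) (auto simp: algebra_simps)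
          then show "c * Psi m i j * (c * Psi m l k) * G j k =
            c * Psi m i j * ((if j = k then Psi m l k else 0) - 1 / real m * Psi m l k)"
            by (simp add: mult_ac)
        qed
        also have "\<dots> = c * Psi m i j * (Psi m l j - 1 / real m * (\<Sum>k=1..m. Psi m l k))"
          using j by (simp add: sum_subtractf sum.delta flip: sum_distrib_left sum_divide_distrib)
        also have "\<dots> = c * (Psi m i j * Psi m l j)"
          using Psi_row_sum[OF m il(2)] by simp
        finally show "(\<Sum>k=1..m. c * Psi m i j * (c * Psi m l k) * G j k) =
          c * (Psi m i j * Psi m l j)" .
      qed
      also have "\<dots> = c * (\<Sum>j=1..m. Psi m i j * Psi m l j)"
        by (rule sum_distrib_left[symmetric])
      also have "\<dots> = (if i = l then 1 else 0)"
        using pos Psi_row_gram[OF m il] by (simp add: c_def)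
      finally show "adj (C i) ** C l + adj (C l) ** C i =
          (2 * (if i = l then 1 else 0)) *\<^sub>R mat 1" .
    qed
    ultimately show ?R using n1 n2 by auto
  qed
  show "?M \<longleftrightarrow> ?R" using HM MH RH HR by blast
qed

subsection \<open>Dimension bounds for anticommuting complex structures\<close>

text \<open>The maps act on the whole space and only invariance refers to \<open>V\<close>. Passing
  to a common fixed space therefore changes \<open>V\<close> but not the maps or their
  relations.\<close>

definition real_clifford :: "nat \<Rightarrow> (nat \<Rightarrow> 'v \<Rightarrow> 'v::euclidean_space) \<Rightarrow> 'v set \<Rightarrow> bool" where
  "real_clifford k A V \<longleftrightarrow> subspace V \<and>
     (\<forall>i<k. linear (A i) \<and> (\<forall>x. A i (A i x) = - x) \<and>
        (\<forall>x y. inner (A i x) y = - inner x (A i y)) \<and> (\<forall>x\<in>V. A i x \<in> V)) \<and>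
     (\<forall>i<k. \<forall>j<k. i \<noteq> j \<longrightarrow> (\<forall>x. A i (A j x) = - A j (A i x)))"

text \<open>The injective map \<open>A\<close> exchanges the eigenspaces of \<open>T\<close> for 1
  and -1, so these have equal dimension, and \<open>V\<close> is their direct sum.\<close>

lemma dim_eq_twice_fixed_space:
  fixes T A :: "'v::euclidean_space \<Rightarrow> 'v"
  assumes V: "subspace V" and T: "linear T" "\<And>x. T (T x) = x" "\<And>x. x \<in> V \<Longrightarrow> T x \<in> V"
    and A: "linear A" "\<And>x. A (A x) = - x" "\<And>x. T (A x) = - A (T x)" "\<And>x. x \<in> V \<Longrightarrow> A x \<in> V"
  shows "subspace {x\<in>V. T x = x}" "dim V = 2 * dim {x\<in>V. T x = x}"
proof -
  let ?P = "{x\<in>V. T x = x}" and ?M = "{x\<in>V. T x = - x}"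
  show P: "subspace ?P"
    using V by (auto intro!: subspaceI simp: subspace_0 subspace_add subspace_scale
        linear_0[OF T(1)] linear_add[OF T(1)] linear_scale[OF T(1)])
  have M: "subspace ?M"
    using V by (auto intro!: subspaceI simp: subspace_0 subspace_add subspace_scale
        linear_0[OF T(1)] linear_add[OF T(1)] linear_scale[OF T(1)])
  have "inj A"
  proof (rule injI)
    fix x y assume "A x = A y"
    then have "A (A x) = A (A y)" by (simp only:)
    then show "x = y" unfolding A(2) by simp
  qed
  then have inj: "inj_on A X" for X by (rule inj_on_subset) simp
  have d: "dim (A ` X) = dim X" for X by (rule dim_image_eq[OF A(1) inj])
  have "A ` ?P \<subseteq> ?M" "A ` ?M \<subseteq> ?P"
    using A(3,4) by (auto simp: linear_neg[OF A(1)])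
  from this[THEN dim_subset] have PM: "dim ?P = dim ?M" unfolding d by (rule antisym)
  have "{x + y |x y. x \<in> ?P \<and> y \<in> ?M} = V"
  proof
    show "{x + y |x y. x \<in> ?P \<and> y \<in> ?M} \<subseteq> V" using V by (auto simp: subspace_add)
    show "V \<subseteq> {x + y |x y. x \<in> ?P \<and> y \<in> ?M}"
    proof
      fix x assume x: "x \<in> V"
      have "x = (1/2) *\<^sub>R (x + T x) + (1/2) *\<^sub>R (x - T x)"
        by (simp add: algebra_simps flip: scaleR_add_left)
      moreover have "(1/2) *\<^sub>R (x + T x) \<in> ?P" "(1/2) *\<^sub>R (x - T x) \<in> ?M"
        using x V T by (auto simp: subspace_add subspace_diff subspace_scale linear_add[OF T(1)]
            linear_diff[OF T(1)] linear_scale[OF T(1)] algebra_simps)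
      ultimately show "x \<in> {x + y |x y. x \<in> ?P \<and> y \<in> ?M}" by blast
    qed
  qed
  moreover have "?P \<inter> ?M = {0}"
    using V T(1) by (auto simp: subspace_0 linear_0 eq_neg_iff_add_eq_0 simp flip: scaleR_2)
  ultimately show "dim V = 2 * dim ?P"
    using dim_sums_Int[OF P M] PM by simp
qed

text \<open>Skewness makes orthogonal complements of invariant subspaces invariant, so cyclic subspaces can
  be split off one after the other.\<close>

lemma dvd_dim_if_cyclic:
  fixes \<A> :: "('v::euclidean_space \<Rightarrow> 'v) set"
  assumes skew: "\<And>A x y. A \<in> \<A> \<Longrightarrow> inner (A x) y = - inner x (A y)"
    and cyc: "\<And>v. v \<noteq> 0 \<Longrightarrow> \<exists>S. subspace S \<and> v \<in> S \<and> dim S = q \<and> (\<forall>A\<in>\<A>. \<forall>x\<in>S. A x \<in> S) \<and>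
      (\<forall>V. subspace V \<longrightarrow> (\<forall>A\<in>\<A>. \<forall>x\<in>V. A x \<in> V) \<longrightarrow> v \<in> V \<longrightarrow> S \<subseteq> V)"
    and V: "subspace V" "\<And>A x. A \<in> \<A> \<Longrightarrow> x \<in> V \<Longrightarrow> A x \<in> V"
  shows "q dvd dim V"
  using V
proof (induction "dim V" arbitrary: V rule: less_induct)
  case less
  show ?case
  proof (cases "V \<subseteq> {0}")
    case True
    then have "dim V = 0" using dim_eq_0[of V] by blast
    then show ?thesis by (simp only: dvd_0_right)
  next
    case False
    then obtain v where v: "v \<in> V" "v \<noteq> 0" by blast
    from cyc[OF v(2)] obtain S where S: "subspace S" "v \<in> S" "dim S = q"
      "\<And>A x. A \<in> \<A> \<Longrightarrow> x \<in> S \<Longrightarrow> A x \<in> S" "S \<subseteq> V"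
      using v less.prems by metis
    let ?W = "{y\<in>V. \<forall>x\<in>S. orthogonal x y}"
    have dW: "dim ?W + dim S = dim V"
      by (rule dim_subspace_orthogonal_to_vectors[OF S(1) less.prems(1) S(5)])
    have "\<not> S \<subseteq> {0}" using S(2) v(2) by blast
    then have "dim S > 0" using dim_eq_0[of S] by linarith
    then have lt: "dim ?W < dim V" using dW by linarith
    have sub: "subspace ?W"
      using less.prems(1) by (auto intro!: subspaceI simp: subspace_0 subspace_add subspace_scale
          orthogonal_def inner_add_right)
    have inv: "A x \<in> ?W" if "A \<in> \<A>" "x \<in> ?W" for A x
    proof -
      have "inner y (A x) = 0" if "y \<in> S" for y
        using skew[OF \<open>A \<in> \<A>\<close>, of y x] S(4)[OF \<open>A \<in> \<A>\<close> that] \<open>x \<in> ?W\<close>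
        by (auto simp: orthogonal_def)
      then show ?thesis using that less.prems(2) by (auto simp: orthogonal_def)
    qed
    have "q dvd dim ?W" by (rule less.hyps) (fact lt sub inv)+
    then show ?thesis using dW S(3) dvd_add[of q "dim ?W" q] by simp
  qed
qed

section \<open>One complex structure and quaternionic structures\<close>

lemma dim_span_orthogonal:
  fixes S :: "'v::euclidean_space set"
  assumes "pairwise orthogonal S" "0 \<notin> S"
  shows "dim (span S) = card S"
  using pairwise_orthogonal_independent[OF assms] by (simp add: dim_eq_card_independent)

text \<open>The cyclic subspace of a nonzero \<open>v\<close> is spanned by the orthogonal vectors
  \<open>v\<close> and \<open>I v\<close>.\<close>

lemma real_clifford_1:
  assumes "real_clifford 1 A V" shows "2 dvd dim V"
proof -
  define I where "I = A 0"
  have I: "linear I" "\<And>x. I (I x) = - x" "\<And>x y. inner (I x) y = - inner x (I y)"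
    "\<And>x. x \<in> V \<Longrightarrow> I x \<in> V" and V: "subspace V"
    using assms by (auto simp: real_clifford_def I_def)
  have cyc: "\<exists>S. subspace S \<and> v \<in> S \<and> dim S = 2 \<and> (\<forall>A\<in>{I}. \<forall>x\<in>S. A x \<in> S) \<and>
      (\<forall>V. subspace V \<longrightarrow> (\<forall>A\<in>{I}. \<forall>x\<in>V. A x \<in> V) \<longrightarrow> v \<in> V \<longrightarrow> S \<subseteq> V)" if "v \<noteq> 0" for v
  proof (intro exI[of _ "span {v, I v}"] conjI allI impI ballI)
    have o: "inner v (I v) = 0" using I(3)[of v v] by (simp add: inner_commute)
    have n: "I v \<noteq> 0" using I(2)[of v] that linear_0[OF I(1)] by auto
    have "v \<noteq> I v" using o that by (metis inner_eq_zero_iff)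
    moreover have "dim (span {v, I v}) = card {v, I v}"
      by (rule dim_span_orthogonal)
        (use that o n in \<open>auto simp: pairwise_def orthogonal_def inner_commute\<close>)
    ultimately show "dim (span {v, I v}) = 2" by simp
    fix A x assume "A \<in> {I}" "x \<in> span {v, I v}"
    then have "A x \<in> I ` span {v, I v}" by auto
    also have "\<dots> = span (I ` {v, I v})" by (rule linear_span_image[OF I(1), symmetric])
    also have "\<dots> \<subseteq> span {v, I v}"
      by (rule span_minimal) (auto simp: I(2) span_base span_neg)
    finally show "A x \<in> span {v, I v}" .
  qed (rule subspace_span, rule span_base, simp, rule span_minimal, auto)
  show ?thesis
    by (rule dvd_dim_if_cyclic[of "{I}" 2 V];
        (rule cyc, assumption | use I V in \<open>simp; fail\<close>))
qed

text \<open>\<open>I\<close> and \<open>J\<close> generate the quaternions, and the orbit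
  \<open>v\<close>, \<open>I v\<close>, \<open>J v\<close>, \<open>J (I v)\<close> is an orthogonal
  basis of the cyclic subspace. The two maps are stated separately because they are also
  instantiated with products of the given structures.\<close>

lemma quaternionic_dim:
  fixes I J :: "'v::euclidean_space \<Rightarrow> 'v"
  assumes I: "linear I" "\<And>x. I (I x) = - x" "\<And>x y. inner (I x) y = - inner x (I y)"
      "\<And>x. x \<in> V \<Longrightarrow> I x \<in> V"
    and J: "linear J" "\<And>x. J (J x) = - x" "\<And>x y. inner (J x) y = - inner x (J y)"
      "\<And>x. x \<in> V \<Longrightarrow> J x \<in> V"
    and V: "subspace V" and IJ: "\<And>x. I (J x) = - J (I x)"
  shows "4 dvd dim V"
proof -
  have cyc: "\<exists>S. subspace S \<and> v \<in> S \<and> dim S = 4 \<and> (\<forall>A\<in>{I, J}. \<forall>x\<in>S. A x \<in> S) \<and>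
      (\<forall>V. subspace V \<longrightarrow> (\<forall>A\<in>{I, J}. \<forall>x\<in>V. A x \<in> V) \<longrightarrow> v \<in> V \<longrightarrow> S \<subseteq> V)" if "v \<noteq> 0" for v
  proof (intro exI[of _ "span {v, I v, J v, J (I v)}"] conjI allI impI ballI)
    let ?B = "{v, I v, J v, J (I v)}"
    have skew: "inner x (I x) = 0" "inner x (J x) = 0" for x
      using I(3)[of x x] J(3)[of x x] by (simp_all add: inner_commute)
    have o: "inner v (I v) = 0" "inner v (J v) = 0" "inner v (J (I v)) = 0"
      "inner (I v) (J v) = 0" "inner (I v) (J (I v)) = 0" "inner (J v) (J (I v)) = 0"
    proof -
      \<comment> \<open>Moving \<open>J\<close> across gives one sign, moving \<open>I\<close>
        across and anticommuting gives the other, so both inner products equal their own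
        negatives.\<close>
      have a: "inner v (J (I v)) = - inner (J v) (I v)" using J(3)[of v "I v"] by simp
      have b: "inner (I v) (J v) = - inner v (I (J v))" using I(3) by simp
      then have "inner (I v) (J v) = inner v (J (I v))" by (simp add: IJ)
      then show "inner v (J (I v)) = 0" "inner (I v) (J v) = 0"
        using a by (simp_all add: inner_commute)
      show "inner (J v) (J (I v)) = 0"
        using J(3)[of v "J (I v)"] skew(1)[of v] by (simp add: J(2))
    qed (use skew in auto)
    have n: "I v \<noteq> 0" "J v \<noteq> 0" "J (I v) \<noteq> 0"
      using I(2)[of v] J(2)[of v] J(2)[of "I v"] that linear_0[OF I(1)] linear_0[OF J(1)] by auto
    have "v \<noteq> I v" "v \<noteq> J v" "v \<noteq> J (I v)" "I v \<noteq> J v" "I v \<noteq> J (I v)" "J v \<noteq> J (I v)"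
      using o that n by (metis inner_eq_zero_iff)+
    then have "card ?B = 4" by simp
    moreover have "dim (span ?B) = card ?B"
      by (rule dim_span_orthogonal)
        (use that o n in \<open>auto simp: pairwise_def orthogonal_def inner_commute\<close>)
    ultimately show "dim (span ?B) = 4" by simp
    have span_B: "x \<in> span ?B" if "x \<in> ?B" for x using that by (rule span_base)
    fix A x assume A: "A \<in> {I, J}" "x \<in> span ?B"
    then have "A x \<in> A ` span ?B" by auto
    also have "\<dots> = span (A ` ?B)"
      by (rule linear_span_image[symmetric]) (use A I(1) J(1) in auto)
    also have "\<dots> \<subseteq> span ?B"
    proof (rule span_minimal)
      have "I (J (I v)) = J v" using IJ[of "I v"] I(2)[of v] linear_neg[OF J(1)] by simp
      then have "A y \<in> span ?B" if "y \<in> ?B" for y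
        using that A(1) I(2) J(2) IJ
        by (auto intro!: span_neg intro: span_B)
      then show "A ` ?B \<subseteq> span ?B" by blast
    qed simp
    finally show "A x \<in> span ?B" .
  qed (rule subspace_span, rule span_base, simp, rule span_minimal, auto)
  show ?thesis
    by (rule dvd_dim_if_cyclic[of "{I, J}" 4 V];
        (rule cyc, assumption | use I J V in \<open>auto; fail\<close>))
qed

text \<open>The last rule is oriented: smaller indices move outwards. Together with the squares it
  brings every word in the structures to a sorted normal form, so identities between products can be
  checked by rewriting.\<close>

lemma real_cliffordD:
  assumes "real_clifford k A V"
  shows "subspace V" "i < k \<Longrightarrow> linear (A i)" "i < k \<Longrightarrow> A i (A i x) = - x"
    "i < k \<Longrightarrow> inner (A i x) y = - inner x (A i y)" "i < k \<Longrightarrow> x \<in> V \<Longrightarrow> A i x \<in> V"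
    "i < k \<Longrightarrow> A i (- x) = - A i x"
    "i < j \<Longrightarrow> j < k \<Longrightarrow> A j (A i x) = - A i (A j x)"
proof -
  show lin: "linear (A i)" if "i < k"
    using assms that unfolding real_clifford_def by blast
  then show "i < k \<Longrightarrow> A i (- x) = - A i x"
    by (rule linear_neg)
  show "A j (A i x) = - A i (A j x)" if "i < j" "j < k"
  proof -
    have "i < k" "j \<noteq> i" using that by simp_all
    then show ?thesis using assms that(2) unfolding real_clifford_def by blast
  qed
qed (use assms in \<open>unfold real_clifford_def, blast\<close>)+

lemma real_clifford_shift:
  assumes A: "real_clifford (k + m) A V"
    and W: "subspace W" "\<And>i x. i < k \<Longrightarrow> x \<in> W \<Longrightarrow> A (i + m) x \<in> W"
  shows "real_clifford k (\<lambda>i. A (i + m)) W"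
  unfolding real_clifford_def
proof (intro conjI allI impI ballI)
  fix i x y assume "i < k"
  then have i: "i + m < k + m" by simp
  show "linear (A (i + m))" "A (i + m) (A (i + m) x) = - x"
    "inner (A (i + m) x) y = - inner x (A (i + m) y)"
    by (rule real_cliffordD[OF A] i)+
next
  fix i j x assume "i < k" "j < k" "i \<noteq> j"
  then have "i + m < k + m" "j + m < k + m" "i + m \<noteq> j + m" by simp_all
  then show "A (i + m) (A (j + m) x) = - A (j + m) (A (i + m) x)"
    using A unfolding real_clifford_def by blast
qed (use W in blast)+

text \<open>The words \<open>0123\<close>, \<open>0145\<close>, \<open>0167\<close>, \<open>0246\<close> span the extended Hamming code, which is doubly even
  and self-dual, so that the corresponding products are commuting involutions.\<close>

lemma real_clifford_8:
  assumes "real_clifford (k + 8) A V"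
  obtains W where "real_clifford k (\<lambda>i. A (i + 8)) W" "dim V = 16 * dim W"
proof -
  note C = real_cliffordD[OF assms]
  have D: "i < 8 \<Longrightarrow> linear (A i)" "i < 8 \<Longrightarrow> A i (A i x) = - x" "i < 8 \<Longrightarrow> x \<in> V \<Longrightarrow> A i x \<in> V"
    "i < 8 \<Longrightarrow> A i (- x) = - A i x" for i x
    by (rule C; simp)+
  have swap: "A j (A i x) = - A i (A j x)" if "i < j" "j < 8" for i j x
    by (rule C(7)) (use that in simp_all)
  have swap': "A (i + 8) (A j x) = - A j (A (i + 8) x)" if "i < k" "j < 8" for i j x
    by (rule C(7)) (use that in simp_all)
  have lin: "linear (\<lambda>x. A i (A j x))" if "i < 8" "j < 8" for i j
    using linear_compose[OF D(1)[OF that(2)] D(1)[OF that(1)]] by (simp add: o_def)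
  have lin4: "linear (\<lambda>x. A a (A b (A c (A d x))))"
    if "a < 8" "b < 8" "c < 8" "d < 8" for a b c d
    using linear_compose[OF lin[OF that(3,4)] lin[OF that(1,2)]] by (simp add: o_def)
  define T1 where "T1 x = A 0 (A 1 (A 2 (A 3 x)))" for x
  define T2 where "T2 x = A 0 (A 1 (A 4 (A 5 x)))" for x
  define T3 where "T3 x = A 0 (A 1 (A 6 (A 7 x)))" for x
  define T4 where "T4 x = A 0 (A 2 (A 4 (A 6 x)))" for x
  note T = T1_def T2_def T3_def T4_def
  have linT: "linear T1" "linear T2" "linear T3" "linear T4"
    unfolding T by (rule lin4; simp)+
  have sq: "T1 (T1 x) = x" "T2 (T2 x) = x" "T3 (T3 x) = x" "T4 (T4 x) = x" for x
    by (simp_all add: T D swap)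
  have comm: "T1 (T2 x) = T2 (T1 x)" "T1 (T3 x) = T3 (T1 x)" "T1 (T4 x) = T4 (T1 x)"
    "T2 (T3 x) = T3 (T2 x)" "T2 (T4 x) = T4 (T2 x)" "T3 (T4 x) = T4 (T3 x)" for x
    by (simp_all add: T D swap)
  have TV: "T1 x \<in> V" "T2 x \<in> V" "T3 x \<in> V" "T4 x \<in> V" if "x \<in> V" for x
    using that by (simp_all add: T D)
  define V1 where "V1 = {x\<in>V. T1 x = x}"
  define V2 where "V2 = {x\<in>V1. T2 x = x}"
  define V3 where "V3 = {x\<in>V2. T3 x = x}"
  define V4 where "V4 = {x\<in>V3. T4 x = x}"
  \<comment> \<open>Each involution needs a map that anticommutes with it and commutes with the
    earlier ones. A single structure serves for the first three. It commutes with a word of length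
    four exactly if it does not occur in it, and since \<open>0123\<close>, \<open>0145\<close>,
    \<open>0167\<close> cover all eight indices, the fourth needs the product of \<open>A 0\<close>
    and \<open>A 1\<close>.\<close>
  have anti: "T1 (A 0 x) = - A 0 (T1 x)" "T2 (A 4 x) = - A 4 (T2 x)" "T3 (A 6 x) = - A 6 (T3 x)"
    "T4 (A 0 (A 1 x)) = - A 0 (A 1 (T4 x))" for x
    by (simp_all add: T D swap)
  have pres: "T1 (A 4 x) = A 4 (T1 x)" "T1 (A 6 x) = A 6 (T1 x)" "T2 (A 6 x) = A 6 (T2 x)"
    "T1 (A 0 (A 1 x)) = A 0 (A 1 (T1 x))" "T2 (A 0 (A 1 x)) = A 0 (A 1 (T2 x))"
    "T3 (A 0 (A 1 x)) = A 0 (A 1 (T3 x))" for x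
    by (simp_all add: T D swap)
  note rules = D swap linT sq comm TV lin anti(2-4)[unfolded One_nat_def] pres[unfolded One_nat_def]
  have 1: "subspace V1" "dim V = 2 * dim V1"
    unfolding V1_def
    by (rule dim_eq_twice_fixed_space[of V T1 "A 0"]; use C(1) in \<open>simp add: rules anti(1)\<close>)+
  have 2: "subspace V2" "dim V1 = 2 * dim V2"
    unfolding V2_def
    by (rule dim_eq_twice_fixed_space[of V1 T2 "A 4"];
        use 1(1) in \<open>(simp add: rules; fail) | simp add: rules V1_def\<close>)+
  have 3: "subspace V3" "dim V2 = 2 * dim V3"
    unfolding V3_def
    by (rule dim_eq_twice_fixed_space[of V2 T3 "A 6"];
        use 2(1) in \<open>(simp add: rules; fail) | simp add: rules V1_def V2_def\<close>)+
  have 4: "subspace V4" "dim V3 = 2 * dim V4"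
    unfolding V4_def
    by (rule dim_eq_twice_fixed_space[of V3 T4 "\<lambda>x. A 0 (A 1 x)"];
        use 3(1) in \<open>(simp add: rules; fail) | simp add: rules V1_def V2_def V3_def\<close>)+
  have "A (i + 8) x \<in> V4" if "i < k" "x \<in> V4" for i x
  proof -
    \<comment> \<open>The words have even length and avoid \<open>i + 8\<close>, so the signs
      cancel.\<close>
    have "T1 (A (i + 8) x) = A (i + 8) (T1 x)" "T2 (A (i + 8) x) = A (i + 8) (T2 x)"
      "T3 (A (i + 8) x) = A (i + 8) (T3 x)" "T4 (A (i + 8) x) = A (i + 8) (T4 x)"
      using C(6)[of "i + 8"] that(1) by (simp_all add: T D swap')
    then show ?thesis using that C(5)[of "i + 8" x] by (simp add: V4_def V3_def V2_def V1_def)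
  qed
  then have "real_clifford k (\<lambda>i. A (i + 8)) V4"
    by (rule real_clifford_shift[OF assms 4(1)])
  moreover have "dim V = 16 * dim V4" using 1 2 3 4 by simp
  ultimately show ?thesis by (rule that)
qed

text \<open>The product of all four structures is an involution that anticommutes with each of them.
  Single structures thus leave its fixed space, but products of two preserve it, and
  \<open>A 0 A 1\<close>, \<open>A 1 A 2\<close> make it a quaternionic space: 8 = 2 * 4.\<close>

lemma real_clifford_4:
  assumes "real_clifford 4 A V" shows "8 dvd dim V"
proof -
  note C = real_cliffordD[OF assms]
  have lin: "linear (\<lambda>x. A i (A j x))" if "i < 4" "j < 4" for i j
    using linear_compose[OF C(2)[OF that(2)] C(2)[OF that(1)]] by (simp add: o_def)
  define T where "T x = A 0 (A 1 (A 2 (A 3 x)))" for x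
  have linT: "linear T"
    unfolding T_def using linear_compose[OF lin[of 2 3] lin[of 0 1]] by (simp add: o_def)
  define W where "W = {x\<in>V. T x = x}"
  have 1: "subspace W" "dim V = 2 * dim W"
    unfolding W_def
    by (rule dim_eq_twice_fixed_space[of V T "A 0"]; use C linT in \<open>simp add: T_def\<close>)+
  have comm: "T (A 0 (A 1 x)) = A 0 (A 1 (T x))" "T (A 1 (A 2 x)) = A 1 (A 2 (T x))" for x
    by (simp_all add: T_def C)
  have "4 dvd dim W"
  proof (rule quaternionic_dim[of "\<lambda>x. A 0 (A 1 x)" W "\<lambda>x. A 1 (A 2 x)"])
    show "A 0 (A 1 x) \<in> W" "A 1 (A 2 x) \<in> W" if "x \<in> W" for x
      using that C comm by (simp_all add: W_def)
  qed (use 1 lin C in simp_all)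
  then show ?thesis using 1(2) by auto
qed

text \<open>Eight structures cost a factor of 16. The base cases of 1, 2, 4, 8 structures force 2,
  4, 8, 16, which is where \<open>2 ^ (c + 1)\<close> comes from.\<close>

lemma real_clifford_dim:
  fixes A :: "nat \<Rightarrow> 'v \<Rightarrow> 'v::euclidean_space"
  assumes "c \<le> 3" "real_clifford (8 * b + 2 ^ c) A V"
  shows "2 ^ (c + 1) * 16 ^ b dvd dim V"
  using assms(2)
proof (induction b arbitrary: A V)
  case 0
  from assms(1) consider "c = 0" | "c = 1" | "c = 2" | "c = 3" by linarith
  then show ?case
  proof cases
    case 1
    then show ?thesis using 0 real_clifford_1[of A V] by simp
  next
    case 2
    note C = real_cliffordD[OF 0[unfolded 2]]
    have "4 dvd dim V"
      by (rule quaternionic_dim[of "A 1" V "A 0"]) (use C in simp_all)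
    then show ?thesis using 2 by simp
  next
    case 3
    then show ?thesis using 0 real_clifford_4[of A V] by simp
  next
    case 4
    then have "real_clifford (0 + 8) A V" using 0 by simp
    then obtain W where "dim V = 16 * dim (W :: 'v set)" using real_clifford_8 by blast
    then show ?thesis using 4 by simp
  qed
next
  case (Suc b)
  have "real_clifford ((8 * b + 2 ^ c) + 8) A V" using Suc.prems by (simp add: add_ac)
  then obtain W where "real_clifford (8 * b + 2 ^ c) (\<lambda>i. A (i + 8)) W" "dim V = 16 * dim W"
    by (rule real_clifford_8)
  then show ?case using Suc.IH by (auto simp: mult_ac)
qed

text \<open>\<open>J A 0 A 1\<close> is an involution because the commuting maps \<open>J\<close>
  and \<open>A 0 A 1\<close> both square to -1, and it anticommutes with \<open>A 0\<close>. Two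
  structures thus cost a factor of 2; when none is left, \<open>J\<close> itself still forces an
  even dimension.\<close>

lemma complex_clifford_dim:
  assumes "real_clifford (2 * t) A V"
    and J: "linear J" "\<And>x. J (J x) = - x" "\<And>x y. inner (J x) y = - inner x (J y)"
      "\<And>x. x \<in> V \<Longrightarrow> J x \<in> V" "\<And>i x. i < 2 * t \<Longrightarrow> A i (J x) = J (A i x)"
  shows "2 ^ (t + 1) dvd dim V"
  using assms(1) J(4,5)
proof (induction t arbitrary: A V)
  case 0
  then have "real_clifford 1 (\<lambda>_. J) V" using J by (simp add: real_clifford_def)
  then show ?case using real_clifford_1 by fastforce
next
  case (Suc t)
  note C = real_cliffordD[OF Suc.prems(1)]
  define T where "T x = J (A 0 (A 1 x))" for x
  have linT: "linear T"
    unfolding T_def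
    using linear_compose[OF linear_compose[OF C(2) C(2)] J(1), of 1 0] by (simp add: o_def)
  have Jneg: "J (- x) = - J x" for x using J(1) by (rule linear_neg)
  note rules = C J(2) Jneg Suc.prems(2,3)
  define W where "W = {x\<in>V. T x = x}"
  have 1: "subspace W" "dim V = 2 * dim W"
    unfolding W_def
    by (rule dim_eq_twice_fixed_space[of V T "A 0"]; use linT in \<open>simp add: T_def rules\<close>)+
  have "A (i + 2) x \<in> W" if "i < 2 * t" "x \<in> W" for i x
  proof -
    have "T (A (i + 2) x) = A (i + 2) (T x)" using that(1) by (simp add: T_def rules)
    then show ?thesis using that C(5)[of "i + 2" x] by (simp add: W_def)
  qed
  then have cl: "real_clifford (2 * t) (\<lambda>i. A (i + 2)) W"
    using Suc.prems(1) 1(1) by (intro real_clifford_shift[where V = V]) simp_all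
  have JW: "J x \<in> W" if "x \<in> W" for x
  proof -
    have "T (J x) = J (T x)" by (simp add: T_def rules)
    then show ?thesis using that Suc.prems(2) by (simp add: W_def)
  qed
  have "2 ^ (t + 1) dvd dim W"
    by (rule Suc.IH[OF cl JW]) (simp_all add: Suc.prems(3))
  then show ?case using 1(2) by simp
qed

section \<open>Upper bounds for orthonormal sequences\<close>

lemma minus_matrix_vector: "(- A) *v x = - (A *v (x :: 'a::ring_1^'n))"
  by (simp add: vec_eq_iff matrix_vector_mult_def sum_negf)

text \<open>Multiplication by \<open>adj (C 1)\<close> normalises the first matrix to the identity,
  and orthogonality to the identity means being skew. The shift by 2 skips \<open>C 1\<close> and
  moves from indices starting at 1 to indices starting at 0.\<close>

lemma rho_orthonormal_clifford:
  fixes C :: "nat \<Rightarrow> 'a::real_or_complex^'r^'r"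
  assumes "rho_orthonormal (Suc k) C"
  shows "real_clifford k (\<lambda>i. (*v) (adj (C 1) ** C (i + 2))) UNIV"
proof -
  define D where "D i = adj (C 1) ** C (i + 2)" for i
  have C: "adj (C i) ** C i = mat 1" "C i ** adj (C i) = mat 1"
    "i \<noteq> j \<Longrightarrow> adj (C i) ** C j + adj (C j) ** C i = 0"
    if "i \<in> {1..Suc k}" "j \<in> {1..Suc k}" for i j
    using assms that by (auto simp: rho_orthonormal_def unitary_def)
  have skew: "adj (D i) = - D i" if "i < k" for i
    using C(3)[of 1 "i + 2"] that by (simp add: D_def adj_mult eq_neg_iff_add_eq_0 add.commute)
  \<comment> \<open>Since \<open>D i\<close> is skew, products of the \<open>D i\<close> carry the
    same relations as the products \<open>adj (C i) ** C j\<close>.\<close>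
  have prod: "D i ** D j = - (adj (C (i + 2)) ** C (j + 2))" if "i < k" for i j
  proof -
    have "adj (D i) ** D j = adj (C (i + 2)) ** (C 1 ** adj (C 1)) ** C (j + 2)"
      by (simp add: D_def adj_mult matrix_mul_assoc)
    also have "\<dots> = adj (C (i + 2)) ** C (j + 2)" using C(2)[of 1 1] by simp
    finally have "- (D i ** D j) = adj (C (i + 2)) ** C (j + 2)"
      by (simp add: skew[OF that] matrix_distribs)
    then show ?thesis by (metis minus_minus)
  qed
  have "real_clifford k (\<lambda>i. (*v) (D i)) UNIV"
    unfolding real_clifford_def
  proof (intro conjI allI impI ballI)
    fix i x assume i: "i < k"
    then show "D i *v (D i *v x) = - x"
      using C(1)[of "i + 2" "i + 2"]
      by (simp add: matrix_vector_mul_assoc prod minus_matrix_vector)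
    fix y show "inner (D i *v x) y = - inner x (D i *v y)"
      by (simp add: inner_adj skew[OF i] minus_matrix_vector)
  next
    fix i j x assume ij: "i < k" "j < k" "i \<noteq> j"
    have "D i ** D j + D j ** D i =
        - (adj (C (i + 2)) ** C (j + 2) + adj (C (j + 2)) ** C (i + 2))"
      by (simp add: prod[OF ij(1)] prod[OF ij(2)])
    also have "\<dots> = 0" by (subst C(3)) (use ij in auto)
    finally have "D i ** D j = - (D j ** D i)" by (simp only: eq_neg_iff_add_eq_0)
    then show "D i *v (D j *v x) = - (D j *v (D i *v x))"
      by (simp add: matrix_vector_mul_assoc minus_matrix_vector)
  qed auto
  then show ?thesis by (simp only: D_def)
qed

lemma not_double_dvd_odd_mult: "0 < N \<Longrightarrow> \<not> 2 * N dvd (2 * a + 1) * (N :: nat)"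
  using dvd_times_right_cancel_iff[of N 2 "2 * a + 1"] by simp

text \<open>The resulting \<open>8 * b + 2 ^ c\<close> structures would force twice the exact power
  of 2 in r to divide r.\<close>

lemma rho_orthonormal_real_bound:
  fixes C :: "nat \<Rightarrow> real^'r^'r"
  assumes "CARD('r) = (2 * a + 1) * 2 ^ (4 * b + c)" "c \<le> 3"
  shows "\<not> rho_orthonormal (8 * b + 2 ^ c + 1) C"
proof
  assume "rho_orthonormal (8 * b + 2 ^ c + 1) C"
  then have "rho_orthonormal (Suc (8 * b + 2 ^ c)) C" by simp
  then have "2 ^ (c + 1) * 16 ^ b dvd dim (UNIV :: (real^'r) set)"
    by (rule real_clifford_dim[OF assms(2) rho_orthonormal_clifford])
  moreover have "dim (UNIV :: (real^'r) set) = (2 * a + 1) * 2 ^ (4 * b + c)"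
    using assms(1) by simp
  moreover have "2 ^ (c + 1) * 16 ^ b = 2 * (2 ^ (4 * b + c) :: nat)"
    by (simp add: power_add power_mult)
  ultimately have "2 * 2 ^ (4 * b + c) dvd (2 * a + 1) * (2 ^ (4 * b + c) :: nat)"
    by (simp only:)
  then show False by (rule not_double_dvd_odd_mult[THEN notE, rotated]) simp
qed

text \<open>The real dimension is 2r, with exact power \<open>2 ^ (q + 1)\<close>, whereas
  \<open>2 * (q + 1)\<close> complex linear structures force \<open>2 ^ (q + 2)\<close>.\<close>

lemma rho_orthonormal_complex_bound:
  fixes C :: "nat \<Rightarrow> complex^'r^'r"
  assumes "CARD('r) = (2 * a + 1) * 2 ^ q"
  shows "\<not> rho_orthonormal (2 * q + 3) C"
proof
  assume "rho_orthonormal (2 * q + 3) C"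
  then have "rho_orthonormal (Suc (2 * (q + 1))) C" by (simp add: numeral_3_eq_3)
  note C = rho_orthonormal_clifford[OF this]
  have "2 ^ ((q + 1) + 1) dvd dim (UNIV :: (complex^'r) set)"
  proof (rule complex_clifford_dim[OF C, where J = "(*s) \<i>"])
    show "linear ((*s) \<i> :: complex^'r \<Rightarrow> _)"
      by (rule linearI) (simp_all add: vec_eq_iff distrib_left)
    show "\<i> *s (\<i> *s x) = - x" for x :: "complex^'r" by (simp add: vec_eq_iff)
    show "inner (\<i> *s x) y = - inner x (\<i> *s y)" for x y :: "complex^'r"
      by (simp add: inner_vec_def inner_complex_def flip: sum_negf)
  qed (simp_all add: vec.scale)
  moreover have "dim (UNIV :: (complex^'r) set) = (2 * a + 1) * 2 ^ (q + 1)"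
    using assms by simp
  moreover have "2 ^ ((q + 1) + 1) = 2 * (2 ^ (q + 1) :: nat)"
    by simp
  ultimately have "2 * 2 ^ (q + 1) dvd (2 * a + 1) * (2 ^ (q + 1) :: nat)"
    by (simp only:)
  then show False by (rule not_double_dvd_odd_mult[THEN notE, rotated]) simp
qed

subsection \<open>Pauli strings\<close>

text \<open>A pair \<open>(a, b)\<close> of subsets of \<open>{..<q}\<close> encodes the Pauli string
  \<open>e\<^sub>x \<mapsto> (-1)\<^bsup>|b \<inter> x|\<^esup> e\<^bsub>x \<triangle> a\<^esub>\<close> acting on the \<open>2\<^sup>q\<close>-dimensional space spanned by the subsets \<open>x\<close>
  of \<open>{..<q}\<close>. Two strings anticommute iff the number below is odd; a string squares to \<open>-1\<close> iff
  \<open>|a \<inter> b|\<close> is odd.\<close>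

definition pauli_anticommute :: "nat set \<times> nat set \<Rightarrow> nat set \<times> nat set \<Rightarrow> bool" where
  "pauli_anticommute x y \<longleftrightarrow> odd (card (fst x \<inter> snd y) + card (fst y \<inter> snd x))"

definition pauli_family :: "nat \<Rightarrow> (nat set \<times> nat set) list \<Rightarrow> bool" where
  "pauli_family q xs \<longleftrightarrow> (\<forall>x\<in>set xs. fst x \<subseteq> {..<q} \<and> snd x \<subseteq> {..<q}) \<and>
     sorted_wrt pauli_anticommute xs"

text \<open>The Jordan-Wigner step. On the new position 0 there are three anticommuting strings; two
  are added by themselves, and the third, \<open>({0}, {})\<close>, is tensored with the old family
  shifted by one.\<close>

lemma pauli_family_step_2:
  assumes "pauli_family q xs"
  shows "pauli_family (q + 1)
    (({0}, {0}) # ({}, {0}) # map (\<lambda>x. (insert 0 (Suc ` fst x), Suc ` snd x)) xs)"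
proof -
  define L where "L x = (insert 0 (Suc ` fst x), Suc ` snd x)" for x :: "nat set \<times> nat set"
  have card: "card (insert 0 (Suc ` a) \<inter> Suc ` b) = card (a \<inter> b)" for a b
  proof -
    have "insert 0 (Suc ` a) \<inter> Suc ` b = Suc ` (a \<inter> b)" by auto
    then show ?thesis by (simp add: card_image)
  qed
  have "pauli_anticommute (L x) (L y) = pauli_anticommute x y" for x y
    unfolding pauli_anticommute_def L_def fst_conv snd_conv card ..
  moreover have "pauli_anticommute ({0}, {0}) (L x)" "pauli_anticommute ({}, {0}) (L x)" for x
    by (simp_all add: pauli_anticommute_def L_def)
  moreover have "pauli_anticommute ({0}, {0}) ({}, {0})"
    by (simp add: pauli_anticommute_def)
  ultimately have "sorted_wrt pauli_anticommute (({0}, {0}) # ({}, {0}) # map L xs)"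
    using assms by (simp add: pauli_family_def sorted_wrt_map)
  moreover have "fst (L x) \<subseteq> {..<q + 1} \<and> snd (L x) \<subseteq> {..<q + 1}" if "x \<in> set xs" for x
    using assms that by (fastforce simp: pauli_family_def L_def)
  ultimately have "pauli_family (q + 1) (({0}, {0}) # ({}, {0}) # map L xs)"
    by (auto simp: pauli_family_def)
  then show ?thesis by (simp only: L_def[abs_def])
qed

lemma pauli_family_complex: "\<exists>xs. length xs = 2 * q + 1 \<and> pauli_family q xs"
proof (induction q)
  case 0
  \<comment> \<open>The empty string is the identity; with the factor \<open>\<i>\<close> it will be
    skew, so it counts as a first structure in dimension 1.\<close>
  show ?case by (rule exI[of _ "[({}, {})]"]) (simp add: pauli_family_def)
next
  case (Suc q)
  then obtain xs where "length xs = 2 * q + 1" "pauli_family q xs" by blast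
  then show ?case using pauli_family_step_2[of q xs] by force
qed

text \<open>Over the reals no scalar can turn a symmetric string into a skew one, so each string has
  to be skew by itself.\<close>

definition real_pauli_family :: "nat \<Rightarrow> (nat set \<times> nat set) list \<Rightarrow> bool" where
  "real_pauli_family q xs \<longleftrightarrow> pauli_family q xs \<and> (\<forall>x\<in>set xs. odd (card (fst x \<inter> snd x)))"

text \<open>The first components are the eight subsets of {0, 1, 2, 3} that contain 0. This is what
  makes \<open>({}, {0})\<close> anticommute with every string of the list.\<close>

definition pauli_8 :: "(nat set \<times> nat set) list" where
  "pauli_8 = [({0},{0}), ({0,1},{1}), ({0,2},{1,2}), ({0,1,2},{2,3}), ({0,3},{1,2,3}), ({0,1,3},{3}),
    ({0,2,3},{1,3}), ({0,1,2,3},{2})]"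

lemma real_pauli_8: "real_pauli_family 4 pauli_8"
  by (simp add: real_pauli_family_def pauli_family_def pauli_8_def pauli_anticommute_def)

text \<open>The product of the eight strings of \<^const>\<open>pauli_8\<close> is \<open>({}, {0})\<close> up to sign. It anticommutes
  with all of them, which gives the Bott periodicity step.\<close>

lemma real_pauli_family_step_8:
  assumes "real_pauli_family q xs"
  shows "real_pauli_family (q + 4)
    (pauli_8 @ map (\<lambda>x. ((+) 4 ` fst x, insert 0 ((+) 4 ` snd x))) xs)"
proof -
  define L where "L x = ((+) 4 ` fst x, insert 0 ((+) 4 ` snd x))" for x :: "nat set \<times> nat set"
  have card: "card ((+) 4 ` a \<inter> insert 0 ((+) 4 ` b)) = card (a \<inter> b)" for a b :: "nat set"
  proof -
    have "(+) 4 ` a \<inter> insert 0 ((+) 4 ` b) = (+) 4 ` (a \<inter> b)" by auto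
    then show ?thesis by (simp add: card_image)
  qed
  have "pauli_anticommute (L x) (L y) = pauli_anticommute x y" for x y
    unfolding pauli_anticommute_def L_def fst_conv snd_conv card ..
  moreover have "pauli_anticommute x (L y)" if "x \<in> set pauli_8" for x y
  proof -
    have x: "0 \<in> fst x" "fst x \<subseteq> {..<4}" "snd x \<subseteq> {..<4}"
      using that by (auto simp: pauli_8_def)
    have "fst x \<inter> insert 0 ((+) 4 ` snd y) = {0}" using x(1,2) by fastforce
    moreover have "(+) 4 ` fst y \<inter> snd x = {}" using x(3) by fastforce
    ultimately show ?thesis by (simp add: pauli_anticommute_def L_def)
  qed
  ultimately have "sorted_wrt pauli_anticommute (pauli_8 @ map L xs)"
    using assms real_pauli_8
    by (simp add: real_pauli_family_def pauli_family_def sorted_wrt_append sorted_wrt_map)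
  moreover have "odd (card (fst (L x) \<inter> snd (L x)))" if "x \<in> set xs" for x
    using assms that unfolding L_def fst_conv snd_conv card by (simp add: real_pauli_family_def)
  moreover have "fst (L x) \<subseteq> {..<q + 4} \<and> snd (L x) \<subseteq> {..<q + 4}" if "x \<in> set xs" for x
    using assms that by (fastforce simp: real_pauli_family_def pauli_family_def L_def)
  moreover have "fst x \<subseteq> {..<q + 4} \<and> snd x \<subseteq> {..<q + 4}" if "x \<in> set pauli_8" for x
    using real_pauli_8 that by (fastforce simp: real_pauli_family_def pauli_family_def)
  ultimately have "real_pauli_family (q + 4) (pauli_8 @ map L xs)"
    using real_pauli_8 by (simp add: real_pauli_family_def pauli_family_def ball_Un)
  then show ?thesis by (simp only: L_def[abs_def])
qed

text \<open>The base cases provide 0, 1, 3, 7 structures in dimensions 1, 2, 4, 8, as many as the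
  imaginary units of the reals, complex numbers, quaternions and octonions. The identity, added
  later, accounts for the \<open>+ 1\<close>.\<close>

lemma pauli_family_real:
  assumes "c \<le> 3"
  shows "\<exists>xs. length xs + 1 = 8 * b + 2 ^ c \<and> real_pauli_family (4 * b + c) xs"
proof (induction b)
  case 0
  from assms consider "c = 0" | "c = 1" | "c = 2" | "c = 3" by linarith
  then show ?case
  proof cases
    case 1
    then show ?thesis by (intro exI[of _ "[]"]) (simp add: real_pauli_family_def pauli_family_def)
  next
    case 2
    then show ?thesis
      by (intro exI[of _ "[({0},{0})]"]) (simp add: real_pauli_family_def pauli_family_def)
  next
    case 3
    then show ?thesis
      by (intro exI[of _ "[({0},{0}), ({1},{0,1}), ({0,1},{1})]"])
        (simp add: real_pauli_family_def pauli_family_def pauli_anticommute_def)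
  next
    case 4
    then show ?thesis
      by (intro exI[of _ "[({0},{0}), ({1},{0,1}), ({0,1},{1,2}), ({2},{0,1,2}), ({0,2},{2}),
            ({1,2},{0,2}), ({0,1,2},{1})]"])
        (simp add: real_pauli_family_def pauli_family_def pauli_anticommute_def)
  qed
next
  case (Suc b)
  then obtain xs where "length xs + 1 = 8 * b + 2 ^ c" "real_pauli_family (4 * b + c) xs" by blast
  then show ?case
    using real_pauli_family_step_8[of "4 * b + c" xs]
    by (intro exI[of _ "pauli_8 @ map (\<lambda>x. ((+) 4 ` fst x, insert 0 ((+) 4 ` snd x))) xs"])
      (simp add: pauli_8_def add_ac)
qed

text \<open>The sign attached to \<open>b\<close> is a character of the group of sets under
  symmetric difference.\<close>

lemma minus_one_power_card_sym_diff:
  assumes "finite b"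
  shows "(- 1 :: 'a::ring_1) ^ card (b \<inter> sym_diff x a) = (- 1) ^ card (b \<inter> x) * (- 1) ^ card (a \<inter> b)"
proof -
  let ?u = "b \<inter> x - a" and ?v = "b \<inter> a - x" and ?w = "b \<inter> a \<inter> x"
  have fin: "finite ?u" "finite ?v" "finite ?w" using assms by auto
  have "b \<inter> sym_diff x a = ?u \<union> ?v" "b \<inter> x = ?u \<union> ?w" "a \<inter> b = ?v \<union> ?w"
    by (auto)
  then have "card (b \<inter> sym_diff x a) = card ?u + card ?v" "card (b \<inter> x) = card ?u + card ?w"
    "card (a \<inter> b) = card ?v + card ?w"
    using card_Un_disjoint[OF fin(1,2)] card_Un_disjoint[OF fin(1,3)] card_Un_disjoint[OF fin(2,3)]
    by (simp_all only:) blast+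
  then have "card (b \<inter> x) + card (a \<inter> b) = card (b \<inter> sym_diff x a) + 2 * card ?w" by simp
  then show ?thesis by (simp flip: power_add) (simp add: power_add power_mult)
qed

section \<open>Matrices of Pauli strings\<close>

context
  fixes h :: "'r::finite \<Rightarrow> nat \<times> nat set" and N q :: nat
  assumes h: "bij_betw h UNIV ({..<N} \<times> Pow {..<q})"
begin

definition pauli_flip :: "nat set \<Rightarrow> 'r \<Rightarrow> 'r" where
  "pauli_flip a s = inv h (fst (h s), sym_diff (snd (h s)) a)"

text \<open>The label \<open>h s\<close> consists of a copy number below \<open>N\<close> and a
  subset; copies are never mixed, so the matrix is block diagonal with \<open>N\<close> equal
  blocks. The scalar \<open>p\<close> leaves room for a factor \<open>\<i>\<close>. The sign is read
  off at the row index.\<close>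

definition pauli_matrix :: "'a::real_or_complex \<Rightarrow> nat set \<times> nat set \<Rightarrow> 'a^'r^'r" where
  "pauli_matrix p z = (\<chi> s t. if t = pauli_flip (fst z) s
     then p * (- 1) ^ card (snd z \<inter> snd (h s)) else 0)"

lemma h_flip:
  assumes "a \<subseteq> {..<q}"
  shows "h (pauli_flip a s) = (fst (h s), sym_diff (snd (h s)) a)"
proof -
  have "h s \<in> {..<N} \<times> Pow {..<q}" using h by (auto simp: bij_betw_def)
  then have "(fst (h s), sym_diff (snd (h s)) a) \<in> range h"
    using h assms by (auto simp: bij_betw_def mem_Times_iff)
  then show ?thesis unfolding pauli_flip_def by (rule f_inv_into_f)
qed

lemma flip_eqI: "h s = h t \<Longrightarrow> s = t"
  using h by (auto simp: bij_betw_def dest: injD)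

lemma flip_commute:
  assumes "a \<subseteq> {..<q}" "c \<subseteq> {..<q}"
  shows "pauli_flip a (pauli_flip c s) = pauli_flip c (pauli_flip a s)"
  by (rule flip_eqI) (auto simp: h_flip assms)

lemma flip_flip:
  assumes "a \<subseteq> {..<q}"
  shows "pauli_flip a (pauli_flip a s) = s"
  by (rule flip_eqI) (auto simp: h_flip assms intro!: prod_eqI)

text \<open>Moving the second sign past the first flip costs
  \<open>(- 1) ^ card (fst z \<inter> snd z')\<close>. All other factors are symmetric in the two
  strings, so this sign decides between commuting and anticommuting.\<close>

lemma pauli_matrix_mult:
  fixes p p' :: "'a::real_or_complex"
  assumes "fst z \<subseteq> {..<q}" "snd z' \<subseteq> {..<q}"
  shows "(pauli_matrix p z ** pauli_matrix p' z') $ s $ t =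
    (if t = pauli_flip (fst z') (pauli_flip (fst z) s) then
       (- 1) ^ card (fst z \<inter> snd z') * (p * p' * (- 1) ^ card (snd z \<inter> snd (h s)) *
         (- 1) ^ card (snd z' \<inter> snd (h s))) else 0)"
proof -
  have "finite (snd z')" using assms(2) finite_subset by blast
  then show ?thesis
    by (simp add: matrix_matrix_mult_def pauli_matrix_def mult_delta_left h_flip[OF assms(1)]
        minus_one_power_card_sym_diff)
qed

lemma pauli_matrix_anticommute:
  fixes p p' :: "'a::real_or_complex"
  assumes "fst z \<subseteq> {..<q}" "snd z \<subseteq> {..<q}" "fst z' \<subseteq> {..<q}" "snd z' \<subseteq> {..<q}"
    and "pauli_anticommute z z'"
  shows "pauli_matrix p z ** pauli_matrix p' z' + pauli_matrix p' z' ** pauli_matrix p z = 0"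
proof -
  have "(- 1 :: 'a) ^ card (fst z \<inter> snd z') = - ((- 1) ^ card (fst z' \<inter> snd z))"
    using assms(5) by (auto simp: pauli_anticommute_def minus_one_power_iff)
  then show ?thesis
    by (auto simp: vec_eq_iff pauli_matrix_mult assms flip_commute[of "fst z" "fst z'"] mult_ac)
qed

lemma pauli_matrix_square:
  fixes p :: "'a::real_or_complex"
  assumes "fst z \<subseteq> {..<q}" "snd z \<subseteq> {..<q}" "p * p * (- 1) ^ card (fst z \<inter> snd z) = - 1"
  shows "pauli_matrix p z ** pauli_matrix p z = - mat 1"
proof -
  have e: "(- 1) ^ n * (p * p * (- 1) ^ k * (- 1) ^ k) = p * p * (- 1) ^ n" for n k
    by (simp flip: power_add power_mult_distrib add: mult_ac)
  show ?thesis
    using assms(3) by (auto simp: vec_eq_iff pauli_matrix_mult assms(1,2) flip_flip mat_def e)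
qed

lemma adj_pauli_matrix:
  fixes p :: "'a::real_or_complex"
  assumes "fst z \<subseteq> {..<q}" "snd z \<subseteq> {..<q}" "conjg p * (- 1) ^ card (fst z \<inter> snd z) = - p"
  shows "adj (pauli_matrix p z) = - pauli_matrix p z"
proof -
  have fin: "finite (snd z)" using assms(2) finite_subset by blast
  have c: "conjg ((- 1) ^ k :: 'a) = (- 1) ^ k" for k
    by (simp add: minus_one_power_iff conjg_minus)
  have flip: "s = pauli_flip (fst z) t \<longleftrightarrow> t = pauli_flip (fst z) s" for s t
    using flip_flip[OF assms(1)] by metis
  have "adj (pauli_matrix p z) $ s $ t = (- pauli_matrix p z) $ s $ t" for s t
  proof (cases "t = pauli_flip (fst z) s")
    case True
    then have "adj (pauli_matrix p z) $ s $ t =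
        (conjg p * (- 1) ^ card (fst z \<inter> snd z)) * (- 1) ^ card (snd z \<inter> snd (h s))"
      by (simp add: adj_def pauli_matrix_def flip_flip[OF assms(1)] conjg_mult c h_flip[OF assms(1)]
          minus_one_power_card_sym_diff[OF fin] mult_ac)
    then show ?thesis using True by (simp add: assms(3) pauli_matrix_def)
  next
    case False
    then show ?thesis by (simp add: adj_def pauli_matrix_def flip)
  qed
  then show ?thesis by (simp add: vec_eq_iff)
qed

end

text \<open>Skew matrices with square -1 are unitary and orthogonal to the identity, and for skew
  matrices orthogonality among themselves is anticommutation. The sequence therefore starts with the
  identity and has one more member than the list.\<close>

lemma pauli_family_rho_orthonormal:
  fixes p :: "nat set \<times> nat set \<Rightarrow> 'a::real_or_complex"
  assumes card: "CARD('r::finite) = N * 2 ^ q" and xs: "pauli_family q xs"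
    and p: "\<And>z. z \<in> set xs \<Longrightarrow> conjg (p z) * (- 1) ^ card (fst z \<inter> snd z) = - p z"
      "\<And>z. z \<in> set xs \<Longrightarrow> p z * p z * (- 1) ^ card (fst z \<inter> snd z) = - 1"
  shows "\<exists>C :: nat \<Rightarrow> 'a^'r^'r. rho_orthonormal (length xs + 1) C"
proof -
  have "CARD('r) = card ({..<N} \<times> Pow {..<q})"
    using card by (simp add: card_Pow)
  then obtain h :: "'r \<Rightarrow> nat \<times> nat set" where h: "bij_betw h UNIV ({..<N} \<times> Pow {..<q})"
    using finite_same_card_bij[of "UNIV :: 'r set" "{..<N} \<times> Pow {..<q}"] by auto
  define M where "M i = (pauli_matrix h (p (xs ! i)) (xs ! i) :: 'a^'r^'r)" for i
  have sub: "fst (xs ! i) \<subseteq> {..<q}" "snd (xs ! i) \<subseteq> {..<q}" if "i < length xs" for i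
    using xs that by (auto simp: pauli_family_def)
  have skew: "adj (M i) = - M i" and square: "M i ** M i = - mat 1" if "i < length xs" for i
    unfolding M_def using sub[OF that] p[OF nth_mem[OF that]]
    by (auto intro!: adj_pauli_matrix[OF h] pauli_matrix_square[OF h])
  have less: "M i ** M j + M j ** M i = 0" if "i < j" "j < length xs" for i j
    unfolding M_def using xs that sub[of i] sub[of j]
    by (intro pauli_matrix_anticommute[OF h]) (auto simp: pauli_family_def sorted_wrt_iff_nth_less)
  have anti: "M i ** M j + M j ** M i = 0" if "i < length xs" "j < length xs" "i \<noteq> j" for i j
    using less[of i j] less[of j i] that by (cases i j rule: linorder_cases) (auto simp: add.commute)
  define C where "C i = (if i = 1 then mat 1 else M (i - 2))" for i :: nat
  have "unitary (C i)" if "i \<in> {1..length xs + 1}" for i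
  proof (rule unitaryI, cases "i = 1")
    case True
    then show "adj (C i) ** C i = mat 1" by (simp add: C_def)
  next
    case False
    then have "i - 2 < length xs" using that by auto
    then show "adj (C i) ** C i = mat 1" using False by (simp add: C_def skew square matrix_distribs)
  qed
  moreover have "adj (C i) ** C j + adj (C j) ** C i = 0"
    if "i \<in> {1..length xs + 1}" "j \<in> {1..length xs + 1}" "i \<noteq> j" for i j
  proof -
    have lt: "k - 2 < length xs" if "k \<in> {1..length xs + 1}" "k \<noteq> 1" for k using that by auto
    consider "i = 1" "j \<noteq> 1" | "j = 1" "i \<noteq> 1" | "i \<noteq> 1" "j \<noteq> 1"
      using \<open>i \<noteq> j\<close> by blast
    then show ?thesis
    proof cases
      case 3
      then have "i - 2 \<noteq> j - 2" using that by auto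
      then have 0: "M (i - 2) ** M (j - 2) + M (j - 2) ** M (i - 2) = 0"
        using anti lt that 3 by blast
      have "adj (C i) ** C j + adj (C j) ** C i =
          - (M (i - 2) ** M (j - 2) + M (j - 2) ** M (i - 2))"
        using 3 lt[OF that(1)] lt[OF that(2)] by (simp add: C_def skew matrix_distribs)
      then show ?thesis unfolding 0 by simp
    qed (use lt[OF that(1)] lt[OF that(2)] in \<open>simp_all add: C_def skew\<close>)
  qed
  ultimately have "rho_orthonormal (length xs + 1) C" unfolding rho_orthonormal_def by blast
  then show ?thesis by blast
qed

section \<open>Values of the Radon-Hurwitz numbers\<close>

lemma radon_hurwitz_real:
  assumes "CARD('r::finite) = (2 * a + 1) * 2 ^ (4 * b + c)" "c \<le> 3"
  shows "radon_hurwitz TYPE(real) TYPE('r) = 8 * b + 2 ^ c"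
proof (rule antisym)
  show "radon_hurwitz TYPE(real) TYPE('r) \<le> 8 * b + 2 ^ c"
    using rho_orthonormal_real_bound[OF assms] le_radon_hurwitz_iff[of "8 * b + 2 ^ c + 1", where 'a = real and 'r = 'r]
    by (auto simp: not_le[symmetric])
  obtain xs where xs: "length xs + 1 = 8 * b + 2 ^ c" "real_pauli_family (4 * b + c) xs"
    using pauli_family_real[OF assms(2)] by blast
  then have "\<exists>C :: nat \<Rightarrow> real^'r^'r. rho_orthonormal (length xs + 1) C"
    by (intro pauli_family_rho_orthonormal[OF assms(1), where p = "\<lambda>_. 1"])
      (auto simp: real_pauli_family_def conjg_real_def)
  then show "8 * b + 2 ^ c \<le> radon_hurwitz TYPE(real) TYPE('r)"
    unfolding le_radon_hurwitz_iff using xs(1) by simp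
qed

lemma radon_hurwitz_complex:
  assumes "CARD('r::finite) = (2 * a + 1) * 2 ^ q"
  shows "radon_hurwitz TYPE(complex) TYPE('r) = 2 * q + 2"
proof (rule antisym)
  show "radon_hurwitz TYPE(complex) TYPE('r) \<le> 2 * q + 2"
    using rho_orthonormal_complex_bound[OF assms] le_radon_hurwitz_iff[of "2 * q + 3", where 'a = complex and 'r = 'r]
    by (auto simp: not_le[symmetric])
  obtain xs where xs: "length xs = 2 * q + 1" "pauli_family q xs"
    using pauli_family_complex by blast
  then have "\<exists>C :: nat \<Rightarrow> complex^'r^'r. rho_orthonormal (length xs + 1) C"
    \<comment> \<open>Strings with an even intersection are hermitian with square 1; the factor
      \<open>\<i>\<close> makes them skew with square -1.\<close>
    by (intro pauli_family_rho_orthonormal[OF assms(1),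
          where p = "\<lambda>z. if odd (card (fst z \<inter> snd z)) then 1 else \<i>"])
      (auto simp: conjg_complex_def)
  then show "2 * q + 2 \<le> radon_hurwitz TYPE(complex) TYPE('r)"
    unfolding le_radon_hurwitz_iff using xs(1) by simp
qed

subsection \<open>Isometries and fusion frames\<close>

lemma trace_mult_commute:
  fixes A :: "'a::comm_semiring_1^'n^'m"
  shows "trace (A ** B) = trace (B ** A)"
proof -
  have "trace (A ** B) = (\<Sum>i\<in>UNIV. \<Sum>k\<in>UNIV. A $ i $ k * B $ k $ i)"
    by (simp add: trace_def matrix_matrix_mult_def)
  also have "\<dots> = (\<Sum>k\<in>UNIV. \<Sum>i\<in>UNIV. A $ i $ k * B $ k $ i)"
    by (rule sum.swap)
  also have "\<dots> = trace (B ** A)"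
    by (simp add: trace_def matrix_matrix_mult_def mult.commute)
  finally show ?thesis .
qed

lemma hinner_simps:
  "hinner x (y + z) = hinner x y + hinner x z"
  "hinner x (y - z) = hinner x y - hinner x z"
  "hinner x (c *s y) = c * hinner x y"
  "hinner x (t *\<^sub>R y) = t *\<^sub>R hinner x y"
  "hinner (t *\<^sub>R x) y = t *\<^sub>R hinner x y"
  "hinner x 0 = 0"
  by (simp_all add: hinner_def algebra_simps sum.distrib sum_subtractf sum_distrib_left
      scaleR_sum_right conjg_scaleR)

lemma hinner_sum: "hinner x (sum f S) = (\<Sum>i\<in>S. hinner x (f i))"
  by (induction S rule: infinite_finite_induct) (auto simp: hinner_simps)

lemma hinner_commute: "hinner y x = conjg (hinner x y)"
  by (simp add: hinner_def conjg_sum conjg_mult conjg_conjg mult.commute)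

lemma hinner_self: "hinner x x = (norm x)\<^sup>2 *\<^sub>R (1 :: 'a::real_or_complex)"
proof -
  have "hinner x x = (\<Sum>i\<in>UNIV. (norm (x $ i))\<^sup>2) *\<^sub>R (1 :: 'a)"
    by (simp add: hinner_def conjg_mult_self flip: scaleR_sum_left)
  also have "(\<Sum>i\<in>UNIV. (norm (x $ i))\<^sup>2) = (norm x)\<^sup>2"
    by (simp add: power2_norm_eq_inner inner_vec_def)
  finally show ?thesis .
qed

lemma is_orth_proj_unique:
  fixes P Q :: "'a::real_or_complex^'d^'d"
  assumes U: "vec.subspace U" and P: "is_orth_proj U P" and Q: "is_orth_proj U Q"
  shows "P = Q"
proof -
  have "P *v x = Q *v x" for x
  proof -
    let ?z = "P *v x - Q *v x"
    have "?z \<in> U" using P Q by (auto simp: is_orth_proj_def intro!: vec.subspace_diff[OF U])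
    then have "hinner ?z (x - Q *v x) = 0" "hinner ?z (x - P *v x) = 0"
      using P Q by (auto simp: is_orth_proj_def)
    then have "hinner ?z ((x - Q *v x) - (x - P *v x)) = 0"
      by (simp only: hinner_simps) simp
    then have "hinner ?z ?z = 0" by simp
    then show ?thesis by (simp add: hinner_self)
  qed
  then show ?thesis by (simp add: matrix_eq)
qed

lemma isometry_range:
  fixes \<Phi> :: "'a::real_or_complex^'r^'d"
  assumes "adj \<Phi> ** \<Phi> = mat 1"
  shows "vec.subspace (range ((*v) \<Phi>))" "vec.dim (range ((*v) \<Phi>)) = CARD('r)"
    "is_orth_proj (range ((*v) \<Phi>)) (\<Phi> ** adj \<Phi>)"
proof -
  have inv: "adj \<Phi> *v (\<Phi> *v x) = x" for x
    by (simp add: matrix_vector_mul_assoc assms)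
  then have "inj ((*v) \<Phi>)" by (metis injI)
  then show "vec.dim (range ((*v) \<Phi>)) = CARD('r)"
    by (subst vec.dim_image_eq) (auto simp: vec_dim_card simp del: vec.dim_UNIV)
  show "vec.subspace (range ((*v) \<Phi>))"
    by (rule vec.linear_subspace_image) auto
  show "is_orth_proj (range ((*v) \<Phi>)) (\<Phi> ** adj \<Phi>)"
    unfolding is_orth_proj_def
  proof (intro allI conjI ballI)
    fix x :: "'a^'d"
    show "\<Phi> ** adj \<Phi> *v x \<in> range ((*v) \<Phi>)"
      by (simp flip: matrix_vector_mul_assoc)
    fix u assume "u \<in> range ((*v) \<Phi>)"
    then obtain w where w: "u = \<Phi> *v w" by blast
    have "hinner u (x - \<Phi> ** adj \<Phi> *v x) = hinner w (adj \<Phi> *v x - adj \<Phi> *v (\<Phi> *v (adj \<Phi> *v x)))"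
      by (simp add: w hinner_adj matrix_vector_mult_diff_distrib flip: matrix_vector_mul_assoc)
    then show "hinner u (x - \<Phi> ** adj \<Phi> *v x) = 0"
      by (simp only: inv) (simp add: hinner_simps)
  qed
qed

text \<open>Gram-Schmidt for the \<open>'a\<close>-valued form: by dimension some \<open>u\<close>
  in \<open>U\<close> lies outside the span of the vectors found so far, and its normalised
  component orthogonal to them is the next one.\<close>

lemma orthonormal_sequence:
  fixes U :: "('a::real_or_complex^'d) set"
  assumes U: "vec.subspace U" and "k \<le> vec.dim U"
  shows "\<exists>v :: nat \<Rightarrow> 'a^'d. (\<forall>i<k. v i \<in> U) \<and>
    (\<forall>i<k. \<forall>j<k. hinner (v i) (v j) = (if i = j then 1 else 0))"
  using assms(2)
proof (induction k)
  case (Suc k)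
  then obtain v :: "nat \<Rightarrow> 'a^'d" where v: "\<And>i. i < k \<Longrightarrow> v i \<in> U"
    "\<And>i j. i < k \<Longrightarrow> j < k \<Longrightarrow> hinner (v i) (v j) = (if i = j then 1 else 0)"
    by auto
  have "\<not> U \<subseteq> vec.span (v ` {..<k})"
  proof
    assume "U \<subseteq> vec.span (v ` {..<k})"
    then have "vec.dim U \<le> card (v ` {..<k})"
      by (intro vec.dim_le_card) auto
    also have "\<dots> \<le> k" using card_image_le[of "{..<k}" v] by simp
    finally show False using Suc.prems by simp
  qed
  then obtain u where u: "u \<in> U" "u \<notin> vec.span (v ` {..<k})" by blast
  define w where "w = u - (\<Sum>i<k. hinner (v i) u *s v i)"
  have "w \<noteq> 0"
  proof
    assume "w = 0"
    then have "u = (\<Sum>i<k. hinner (v i) u *s v i)" by (simp add: w_def)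
    also have "\<dots> \<in> vec.span (v ` {..<k})"
      by (intro vec.span_sum vec.span_scale vec.span_base) auto
    finally show False using u by simp
  qed
  have "w \<in> U"
    unfolding w_def using u v(1)
    by (intro vec.subspace_diff[OF U] vec.subspace_sum[OF U] vec.subspace_scale[OF U]) auto
  have vw: "hinner (v i) w = 0" if "i < k" for i
  proof -
    have "hinner (v i) w = hinner (v i) u - (\<Sum>j<k. hinner (v j) u * hinner (v i) (v j))"
      by (simp add: w_def hinner_simps hinner_sum)
    also have "(\<Sum>j<k. hinner (v j) u * hinner (v i) (v j)) =
        (\<Sum>j<k. if i = j then hinner (v i) u else 0)"
      by (intro sum.cong refl) (use that in \<open>auto simp: v(2)\<close>)
    also have "\<dots> = hinner (v i) u" using that by simp
    finally show ?thesis by simp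
  qed
  then have wv: "hinner w (v i) = 0" if "i < k" for i
    using that hinner_commute[of w "v i"] by simp
  define y where "y = (1 / norm w) *\<^sub>R w"
  have "y = ((1 / norm w) *\<^sub>R 1) *s w" by (simp add: y_def vec_eq_iff)
  then have "y \<in> U" using \<open>w \<in> U\<close> vec.subspace_scale[OF U] by simp
  moreover have "hinner y y = 1"
    using \<open>w \<noteq> 0\<close> by (simp add: y_def hinner_simps hinner_self power2_eq_square)
  ultimately show ?case
    using v vw wv
    by (intro exI[of _ "v(k := y)"]) (auto simp: less_Suc_eq y_def hinner_simps)
qed auto

text \<open>An orthonormal basis of the subspace, written as the columns of a matrix, turns
  statements about projections into statements about r x r matrices.\<close>

lemma is_orth_proj_isometry:
  fixes P :: "'a::real_or_complex^'d^'d"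
  assumes U: "vec.subspace U" "vec.dim U = CARD('r::finite)" and P: "is_orth_proj U P"
  shows "\<exists>\<Phi> :: 'a^'r^'d. adj \<Phi> ** \<Phi> = mat 1 \<and> P = \<Phi> ** adj \<Phi>"
proof -
  obtain v where v: "\<And>i. i < CARD('r) \<Longrightarrow> v i \<in> U"
    "\<And>i j. i < CARD('r) \<Longrightarrow> j < CARD('r) \<Longrightarrow> hinner (v i) (v j) = (if i = j then 1 else 0)"
    using orthonormal_sequence[OF U(1), of "CARD('r)"] U(2) by auto
  obtain h :: "'r \<Rightarrow> nat" where h: "bij_betw h UNIV {..<CARD('r)}"
    using finite_same_card_bij[of "UNIV :: 'r set" "{..<CARD('r)}"] by auto
  then have hl: "h s < CARD('r)" and hi: "h s = h t \<longleftrightarrow> s = t" for s t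
    by (auto simp: bij_betw_def inj_eq)
  define \<Phi> :: "'a^'r^'d" where "\<Phi> = (\<chi> d s. v (h s) $ d)"
  have iso: "adj \<Phi> ** \<Phi> = mat 1"
  proof -
    have "(adj \<Phi> ** \<Phi>) $ s $ t = hinner (v (h s)) (v (h t))" for s t
      by (simp add: matrix_matrix_mult_def adj_def \<Phi>_def hinner_def)
    then show ?thesis by (simp add: vec_eq_iff mat_def v(2) hl hi)
  qed
  note R = isometry_range[OF iso]
  have "range ((*v) \<Phi>) \<subseteq> U"
  proof clarify
    fix x
    have "\<Phi> *v x = (\<Sum>s\<in>UNIV. x $ s *s v (h s))"
      by (simp add: vec_eq_iff matrix_vector_mult_def \<Phi>_def mult.commute)
    also have "\<dots> \<in> U"
      by (intro vec.subspace_sum[OF U(1)] vec.subspace_scale[OF U(1)] v(1) hl)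
    finally show "\<Phi> *v x \<in> U" .
  qed
  then have "range ((*v) \<Phi>) = U"
    using vec.subspace_dim_equal[OF R(1) U(1)] R(2) U(2) by simp
  then show ?thesis using is_orth_proj_unique[OF U(1) P] R(3) iso by metis
qed

text \<open>For unitary \<open>X\<close> the first two terms are scalar, so the whole is scalar once
  \<open>X + adj X\<close> is. Both directions between simplices and frames use this.\<close>

lemma matrix_affine_gram:
  fixes X :: "'a::real_or_complex^'r^'r"
  shows "(x *\<^sub>R mat 1 + y *\<^sub>R X) ** (x *\<^sub>R mat 1 + y *\<^sub>R adj X) =
    x\<^sup>2 *\<^sub>R mat 1 + y\<^sup>2 *\<^sub>R (X ** adj X) + (x * y) *\<^sub>R (X + adj X)"
  by (simp add: matrix_distribs power2_eq_square algebra_simps)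

section \<open>From simplices to frames and back\<close>

lemma orthogonal_isometries:
  assumes "CARD('d::finite) = 2 * CARD('r::finite)"
  obtains e f :: "'a::real_or_complex^'r^'d"
  where "adj e ** e = mat 1" "adj f ** f = mat 1" "adj e ** f = 0" "adj f ** e = 0"
    "e ** adj e + f ** adj f = mat 1"
proof -
  have "CARD('r + 'r) = CARD('d)" using assms by simp
  then obtain h :: "'r + 'r \<Rightarrow> 'd" where h: "bij h"
    using finite_same_card_bij[of "UNIV :: ('r + 'r) set" "UNIV :: 'd set"] by auto
  then have inj: "h x = h y \<longleftrightarrow> x = y" for x y by (auto simp: bij_def inj_eq)
  define e :: "'a^'r^'d" where "e = (\<chi> d s. if d = h (Inl s) then 1 else 0)"
  define f :: "'a^'r^'d" where "f = (\<chi> d s. if d = h (Inr s) then 1 else 0)"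
  have conjg_if: "conjg (if b then 1 else 0) = (if b then 1 else (0::'a))" for b by simp
  note defs = vec_eq_iff matrix_matrix_mult_def adj_def e_def f_def mat_def conjg_if inj
    if_distrib[of "\<lambda>x. x * _"]
  have "adj e ** e = mat 1" "adj f ** f = mat 1" "adj e ** f = 0" "adj f ** e = 0"
    by (simp_all add: defs cong: if_cong)
  moreover have "(e ** adj e + f ** adj f) $ d $ d' = (mat 1 :: 'a^'d^'d) $ d $ d'" for d d'
  proof -
    obtain x y where xy: "d = h x" "d' = h y" using h by (metis bij_pointE)
    show ?thesis
      by (cases x; cases y) (simp_all add: defs xy cong: if_cong)
  qed
  then have "e ** adj e + f ** adj f = mat 1" by (simp add: vec_eq_iff)
  ultimately show ?thesis by (rule that)
qed

lemma eitffI: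
  fixes \<Phi> :: "nat \<Rightarrow> 'a::real_or_complex^'r^'d"
  assumes "n \<ge> 2" and iso: "\<And>i. i \<in> {1..n} \<Longrightarrow> adj (\<Phi> i) ** \<Phi> i = mat 1"
    and gram: "\<And>i j. i \<in> {1..n} \<Longrightarrow> j \<in> {1..n} \<Longrightarrow> i \<noteq> j \<Longrightarrow>
      (adj (\<Phi> i) ** \<Phi> j) ** (adj (\<Phi> j) ** \<Phi> i) = \<sigma>\<^sup>2 *\<^sub>R mat 1" and "\<sigma> \<ge> 0"
    and tight: "(\<Sum>i\<in>{1..n}. \<Phi> i ** adj (\<Phi> i)) = a *\<^sub>R mat 1" "a > 0"
  shows "eitff (CARD('r)) n (\<lambda>i. range ((*v) (\<Phi> i)))"
proof -
  have "(\<Phi> i ** adj (\<Phi> i)) ** (\<Phi> j ** adj (\<Phi> j)) ** (\<Phi> i ** adj (\<Phi> i)) =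
      \<sigma>\<^sup>2 *\<^sub>R (\<Phi> i ** adj (\<Phi> i))" if "i \<in> {1..n}" "j \<in> {1..n}" "i \<noteq> j" for i j
  proof -
    have "(\<Phi> i ** adj (\<Phi> i)) ** (\<Phi> j ** adj (\<Phi> j)) ** (\<Phi> i ** adj (\<Phi> i)) =
        \<Phi> i ** ((adj (\<Phi> i) ** \<Phi> j) ** (adj (\<Phi> j) ** \<Phi> i)) ** adj (\<Phi> i)"
      by (simp add: matrix_mul_assoc)
    then show ?thesis by (simp add: gram[OF that] matrix_distribs)
  qed
  then show ?thesis
    unfolding eitff_def using assms(1,4,6) tight(1) isometry_range[OF iso]
    by (intro conjI exI[of _ "\<lambda>i. \<Phi> i ** adj (\<Phi> i)"] exI[of _ \<sigma>] exI[of _ a]) auto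
qed

lemma eitff_if_simplex:
  fixes B :: "nat \<Rightarrow> 'a::real_or_complex^'r^'r"
  assumes n: "n \<ge> 3" and card: "CARD('d::finite) = 2 * CARD('r)"
    and uni: "\<And>i. i \<in> {1..n-1} \<Longrightarrow> unitary (B i)"
    and anti: "\<And>i j. i \<in> {1..n-1} \<Longrightarrow> j \<in> {1..n-1} \<Longrightarrow> i \<noteq> j \<Longrightarrow>
      adj (B i) ** B j + adj (B j) ** B i = (- 2 / (real n - 2)) *\<^sub>R mat 1"
    and sum: "(\<Sum>i=1..n-1. B i) = 0"
  shows "\<exists>U :: nat \<Rightarrow> ('a^'d) set. eitff (CARD('r)) n U"
proof -
  obtain e f :: "'a^'r^'d" where ef: "adj e ** e = mat 1" "adj f ** f = mat 1" "adj e ** f = 0"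
    "adj f ** e = 0" "e ** adj e + f ** adj f = mat 1"
    using orthogonal_isometries[OF card] by blast
  have ef': "X ** adj e ** e = X" "X ** adj f ** f = X" "X ** adj e ** f = 0" "X ** adj f ** e = 0"
    for X :: "'a^'r^'r"
    by (simp_all add: ef flip: matrix_mul_assoc)
  \<comment> \<open>The values satisfy \<alpha>^2 + \<beta>^2 = 1, which makes each
    \<open>\<Phi> i\<close> an isometry, and 1 + (n - 1) \<alpha>^2 = (n - 1) \<beta>^2 = n/2, which
    makes the frame tight.\<close>
  define \<alpha> where "\<alpha> = sqrt ((real n - 2) / (2 * (real n - 1)))"
  define \<beta> where "\<beta> = sqrt (real n / (2 * (real n - 1)))"
  have rn: "real n \<ge> 3" using n by simp
  have \<alpha>: "\<alpha>\<^sup>2 = (real n - 2) / (2 * (real n - 1))" and "\<alpha> \<ge> 0"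
    using rn by (simp_all add: \<alpha>_def)
  have \<beta>: "\<beta>\<^sup>2 = real n / (2 * (real n - 1))"
    using rn by (simp add: \<beta>_def)
  define \<Phi> where "\<Phi> i = (if i = n then e else \<alpha> *\<^sub>R e + \<beta> *\<^sub>R (f ** B i))" for i
  have uni': "adj (B i) ** B i = mat 1" "B i ** adj (B i) = mat 1" if "i \<in> {1..n}" "i \<noteq> n" for i
  proof -
    have "i \<in> {1..n-1}" using that by auto
    then show "adj (B i) ** B i = mat 1" "B i ** adj (B i) = mat 1"
      using uni by (auto simp: unitary_def)
  qed
  have G: "adj (\<Phi> n) ** \<Phi> n = mat 1"
    "i \<noteq> n \<Longrightarrow> adj (\<Phi> i) ** \<Phi> n = \<alpha> *\<^sub>R mat 1"
    "j \<noteq> n \<Longrightarrow> adj (\<Phi> n) ** \<Phi> j = \<alpha> *\<^sub>R mat 1"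
    "i \<noteq> n \<Longrightarrow> j \<noteq> n \<Longrightarrow> adj (\<Phi> i) ** \<Phi> j = \<alpha>\<^sup>2 *\<^sub>R mat 1 + \<beta>\<^sup>2 *\<^sub>R (adj (B i) ** B j)" for i j
    by (simp_all add: \<Phi>_def adj_distribs matrix_distribs matrix_mul_assoc ef ef' power2_eq_square)
  have "eitff (CARD('r)) n (\<lambda>i. range ((*v) (\<Phi> i)))"
  proof (rule eitffI[where \<sigma> = \<alpha> and a = "real n / 2"])
    show "adj (\<Phi> i) ** \<Phi> i = mat 1" if i: "i \<in> {1..n}" for i
    proof (cases "i = n")
      case True
      then show ?thesis using G(1) by simp
    next
      case False
      have "\<alpha>\<^sup>2 + \<beta>\<^sup>2 = 1"
        unfolding \<alpha> \<beta> using rn by (simp flip: add_divide_distrib)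
      then show ?thesis
        using G(4)[OF False False] uni'[OF i False] by (simp flip: scaleR_add_left)
    qed
    show "(adj (\<Phi> i) ** \<Phi> j) ** (adj (\<Phi> j) ** \<Phi> i) = \<alpha>\<^sup>2 *\<^sub>R mat 1"
      if ij: "i \<in> {1..n}" "j \<in> {1..n}" "i \<noteq> j" for i j
    proof (cases "i = n \<or> j = n")
      case True
      then show ?thesis
        using G(2,3) ij(3) by (auto simp: matrix_distribs power2_eq_square)
    next
      case False
      let ?X = "adj (B i) ** B j"
      have in': "i \<in> {1..n-1}" "j \<in> {1..n-1}" using False ij by auto
      have "?X ** adj ?X = adj (B i) ** (B j ** adj (B j)) ** B i"
        by (simp add: adj_mult matrix_mul_assoc)
      then have XX: "?X ** adj ?X = mat 1"
        using uni'(2)[of j] uni'(1)[of i] ij False by simp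
      have Xs: "?X + adj ?X = (- 2 / (real n - 2)) *\<^sub>R mat 1"
        using anti[OF in' ij(3)] by (simp add: adj_mult)
      have "(adj (\<Phi> i) ** \<Phi> j) ** (adj (\<Phi> j) ** \<Phi> i) =
          (\<alpha>\<^sup>2 *\<^sub>R mat 1 + \<beta>\<^sup>2 *\<^sub>R ?X) ** (\<alpha>\<^sup>2 *\<^sub>R mat 1 + \<beta>\<^sup>2 *\<^sub>R adj ?X)"
        using False by (simp add: G(4) adj_mult)
      also have "\<dots> = ((\<alpha>\<^sup>2)\<^sup>2 + (\<beta>\<^sup>2)\<^sup>2 + \<alpha>\<^sup>2 * \<beta>\<^sup>2 * (- 2 / (real n - 2))) *\<^sub>R mat 1"
        unfolding matrix_affine_gram XX Xs by (simp only: scaleR_add_left scaleR_scaleR)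
      also have "(\<alpha>\<^sup>2)\<^sup>2 + (\<beta>\<^sup>2)\<^sup>2 + \<alpha>\<^sup>2 * \<beta>\<^sup>2 * (- 2 / (real n - 2)) = \<alpha>\<^sup>2"
      proof -
        define t where "t = real n - 1"
        have "t > 1" "real n = t + 1" using rn by (simp_all add: t_def)
        then show ?thesis
          unfolding \<alpha> \<beta> by (simp add: field_simps power2_eq_square)
      qed
      finally show ?thesis .
    qed
    have P: "\<Phi> i ** adj (\<Phi> i) = \<alpha>\<^sup>2 *\<^sub>R (e ** adj e) + \<beta>\<^sup>2 *\<^sub>R (f ** adj f) +
        (\<alpha> * \<beta>) *\<^sub>R (e ** adj (f ** B i) + f ** B i ** adj e)" if i: "i \<in> {1..n-1}" for i
    proof -
      have "f ** B i ** adj (B i) ** adj f = f ** (B i ** adj (B i)) ** adj f"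
        by (simp add: matrix_mul_assoc)
      also have "\<dots> = f ** adj f" using uni'(2)[of i] i by auto
      finally show ?thesis
        using i by (auto simp: \<Phi>_def adj_distribs matrix_distribs matrix_mul_assoc power2_eq_square
            algebra_simps)
    qed
    \<comment> \<open>The off-diagonal blocks of the frame operator are linear in the
      \<open>B i\<close> and vanish because the simplex sums to zero.\<close>
    have cross: "(\<Sum>i=1..n-1. e ** adj (f ** B i) + f ** B i ** adj e) = 0"
    proof -
      have "(\<Sum>i=1..n-1. e ** adj (f ** B i) + f ** B i ** adj e) =
          e ** adj (f ** (\<Sum>i=1..n-1. B i)) + f ** (\<Sum>i=1..n-1. B i) ** adj e"
        by (simp only: sum.distrib matrix_sum_right matrix_sum_left adj_sum)
      then show ?thesis unfolding sum by simp
    qed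
    have "(\<Sum>i=1..n-1. \<Phi> i ** adj (\<Phi> i)) =
        (\<Sum>i=1..n-1. \<alpha>\<^sup>2 *\<^sub>R (e ** adj e) + \<beta>\<^sup>2 *\<^sub>R (f ** adj f) +
        (\<alpha> * \<beta>) *\<^sub>R (e ** adj (f ** B i) + f ** B i ** adj e))"
      by (intro sum.cong refl) (simp add: P)
    also have "\<dots> = (\<Sum>i=1..n-1. \<alpha>\<^sup>2 *\<^sub>R (e ** adj e) + \<beta>\<^sup>2 *\<^sub>R (f ** adj f))"
      unfolding sum.distrib[of _ "\<lambda>i. (\<alpha> * \<beta>) *\<^sub>R _ i"] scaleR_sum_right[symmetric] cross by simp
    also have "\<dots> = ((real n - 1) * \<alpha>\<^sup>2) *\<^sub>R (e ** adj e) + ((real n - 1) * \<beta>\<^sup>2) *\<^sub>R (f ** adj f)"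
      unfolding sum_constant_scaleR using n by (simp add: of_nat_diff scaleR_add_right)
    finally have rest: "(\<Sum>i=1..n-1. \<Phi> i ** adj (\<Phi> i)) =
      ((real n - 1) * \<alpha>\<^sup>2) *\<^sub>R (e ** adj e) + ((real n - 1) * \<beta>\<^sup>2) *\<^sub>R (f ** adj f)" .
    have "{1..n} = insert n {1..n-1}" using n by auto
    then have "(\<Sum>i\<in>{1..n}. \<Phi> i ** adj (\<Phi> i)) = e ** adj e + (\<Sum>i=1..n-1. \<Phi> i ** adj (\<Phi> i))"
      using n by (simp add: \<Phi>_def)
    also have "\<dots> = (1 + (real n - 1) * \<alpha>\<^sup>2) *\<^sub>R (e ** adj e) + ((real n - 1) * \<beta>\<^sup>2) *\<^sub>R (f ** adj f)"
      unfolding rest by (simp add: scaleR_add_left)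
    also have "1 + (real n - 1) * \<alpha>\<^sup>2 = real n / 2"
      unfolding \<alpha> using rn by (simp add: field_simps)
    also have "(real n - 1) * \<beta>\<^sup>2 = real n / 2"
      unfolding \<beta> using rn by (simp add: field_simps)
    finally show "(\<Sum>i\<in>{1..n}. \<Phi> i ** adj (\<Phi> i)) = (real n / 2) *\<^sub>R mat 1"
      by (simp add: ef(5) flip: scaleR_add_right)
  qed (use n \<open>\<alpha> \<ge> 0\<close> in auto)
  then show ?thesis by blast
qed

lemma simplex_if_eitff:
  fixes U :: "nat \<Rightarrow> ('a::real_or_complex^'d) set"
  assumes n: "n \<ge> 3" and card: "CARD('d) = 2 * CARD('r::finite)"
    and "eitff (CARD('r)) n U"
  shows "\<exists>B :: nat \<Rightarrow> 'a^'r^'r. (\<forall>i\<in>{1..n-1}. unitary (B i)) \<and>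
    (\<forall>i\<in>{1..n-1}. \<forall>j\<in>{1..n-1}. i \<noteq> j \<longrightarrow>
      adj (B i) ** B j + adj (B j) ** B i = (- 2 / (real n - 2)) *\<^sub>R mat 1)"
proof -
  obtain P \<sigma> a where U: "\<And>i. i \<in> {1..n} \<Longrightarrow> vec.subspace (U i)"
      "\<And>i. i \<in> {1..n} \<Longrightarrow> vec.dim (U i) = CARD('r)"
      "\<And>i. i \<in> {1..n} \<Longrightarrow> is_orth_proj (U i) (P i)"
    and \<sigma>: "\<sigma> \<ge> 0" and iso: "\<And>i j. i \<in> {1..n} \<Longrightarrow> j \<in> {1..n} \<Longrightarrow> i \<noteq> j \<Longrightarrow>
      P i ** P j ** P i = \<sigma>\<^sup>2 *\<^sub>R P i"
    and tight: "(\<Sum>i\<in>{1..n}. P i) = a *\<^sub>R mat 1"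
    using assms(3) unfolding eitff_def by blast
  have ex: "\<exists>\<Psi> :: 'a^'r^'d. adj \<Psi> ** \<Psi> = mat 1 \<and> P i = \<Psi> ** adj \<Psi>" if "i \<in> {1..n}" for i
    by (rule is_orth_proj_isometry[OF U[OF that]])
  have herm: "adj (P i) = P i" and idem: "P i ** P i = P i"
    and trP: "re (trace (P i)) = real CARD('r)" if "i \<in> {1..n}" for i
  proof -
    obtain \<Psi> :: "'a^'r^'d" where \<Psi>: "adj \<Psi> ** \<Psi> = mat 1" "P i = \<Psi> ** adj \<Psi>"
      using ex[OF \<open>i \<in> {1..n}\<close>] by blast
    show "adj (P i) = P i" by (simp add: \<Psi> adj_mult)
    have "P i ** P i = \<Psi> ** (adj \<Psi> ** \<Psi>) ** adj \<Psi>"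
      by (simp only: \<Psi>(2) matrix_mul_assoc)
    then show "P i ** P i = P i" by (simp only: \<Psi>(1) matrix_mul_rid) (simp only: \<Psi>(2))
    have "re (trace (P i)) = re (trace (adj \<Psi> ** \<Psi>))" by (simp only: \<Psi>(2) trace_mult_commute[of \<Psi>])
    then show "re (trace (P i)) = real CARD('r)" by (simp only: \<Psi>(1) re_trace_mat_1)
  qed
  obtain \<Phi> :: "'a^'r^'d" where \<Phi>: "adj \<Phi> ** \<Phi> = mat 1" "P n = \<Phi> ** adj \<Phi>"
    using ex[of n] n by auto
  have P\<Phi>: "P n ** \<Phi> = \<Phi>" "adj \<Phi> ** P n = adj \<Phi>"
  proof -
    have "P n ** \<Phi> = \<Phi> ** (adj \<Phi> ** \<Phi>)" "adj \<Phi> ** P n = (adj \<Phi> ** \<Phi>) ** adj \<Phi>"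
      by (simp_all only: \<Phi>(2) matrix_mul_assoc)
    then show "P n ** \<Phi> = \<Phi>" "adj \<Phi> ** P n = adj \<Phi>" by (simp_all add: \<Phi>(1))
  qed
  \<comment> \<open>Isoclinism with the last subspace, read in its own coordinates:
    \<open>(1 / \<sigma>) *\<^sub>R (P i ** \<Phi>)\<close> will be an isometry as soon as \<sigma>
    is known to be nonzero.\<close>
  have comp: "adj \<Phi> ** P i ** \<Phi> = \<sigma>\<^sup>2 *\<^sub>R mat 1" if "i \<in> {1..n}" "i \<noteq> n" for i
  proof -
    have "adj \<Phi> ** P i ** \<Phi> = adj \<Phi> ** (P n ** P i ** P n) ** \<Phi>"
      by (simp add: matrix_mul_assoc P\<Phi>) (simp add: P\<Phi> flip: matrix_mul_assoc)
    also have "\<dots> = \<sigma>\<^sup>2 *\<^sub>R (adj \<Phi> ** P n ** \<Phi>)"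
      using iso[of n i] that n by (simp add: matrix_distribs)
    finally show ?thesis by (simp add: P\<Phi> \<Phi>(1))
  qed
  have rn: "real n \<ge> 3" using n by simp
  have "real n * real CARD('r) = (\<Sum>i\<in>{1..n}. re (trace (P i)))"
    by (simp add: trP)
  also have "\<dots> = re (trace (\<Sum>i\<in>{1..n}. P i))"
    unfolding trace_def by (simp add: re_sum) (rule sum.swap)
  also have "\<dots> = a * (2 * real CARD('r))"
    by (simp only: tight trace_scaleR re_scaleR re_trace_mat_1 card)
  finally have a: "a = real n / 2" by (simp add: field_simps)
  have "a *\<^sub>R (mat 1 :: 'a^'r^'r) = adj \<Phi> ** (\<Sum>i\<in>{1..n}. P i) ** \<Phi>"
    unfolding tight by (simp add: matrix_distribs \<Phi>(1))
  also have "\<dots> = (\<Sum>i\<in>{1..n}. adj \<Phi> ** P i ** \<Phi>)"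
    by (simp only: matrix_sum_left matrix_sum_right)
  also have "{1..n} = insert n {1..n-1}" using n by auto
  also have "(\<Sum>i\<in>insert n {1..n-1}. adj \<Phi> ** P i ** \<Phi>) =
      adj \<Phi> ** P n ** \<Phi> + (\<Sum>i\<in>{1..n-1}. adj \<Phi> ** P i ** \<Phi>)"
    using n by (intro sum.insert) auto
  also have "(\<Sum>i\<in>{1..n-1}. adj \<Phi> ** P i ** \<Phi>) = (\<Sum>i\<in>{1..n-1}. \<sigma>\<^sup>2 *\<^sub>R mat 1)"
    by (intro sum.cong refl comp) auto
  also have "adj \<Phi> ** P n ** \<Phi> + (\<Sum>i\<in>{1..n-1}. \<sigma>\<^sup>2 *\<^sub>R mat 1) = (1 + (real n - 1) * \<sigma>\<^sup>2) *\<^sub>R mat 1"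
    unfolding sum_constant_scaleR using n by (simp add: P\<Phi> \<Phi>(1) of_nat_diff scaleR_add_left)
  finally have "a *\<^sub>R (mat 1 :: 'a^'r^'r) = (1 + (real n - 1) * \<sigma>\<^sup>2) *\<^sub>R mat 1" .
  from arg_cong[OF this, of "\<lambda>M. M $ undefined $ undefined"]
  have "a = 1 + (real n - 1) * \<sigma>\<^sup>2" by (simp add: mat_def)
  then have \<sigma>2: "\<sigma>\<^sup>2 = (real n - 2) / (2 * (real n - 1))"
    using a rn by (simp add: field_simps)
  then have "\<sigma>\<^sup>2 > 0" using rn by simp
  then have \<sigma>0: "\<sigma> \<noteq> 0" by auto
  define \<beta> where "\<beta> = real n / (2 * (real n - 1))"
  have \<beta>: "\<beta> = 1 - \<sigma>\<^sup>2" "\<beta> > 0" using rn by (simp_all add: \<beta>_def \<sigma>2 field_simps)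
  \<comment> \<open>\<open>Q i\<close> is the component of the isometry
    \<open>(1 / \<sigma>) *\<^sub>R (P i ** \<Phi>)\<close> orthogonal to the last subspace, and
    \<open>G\<close> is the Gram matrix of these isometries.\<close>
  define Q where "Q i = (1 / \<sigma>) *\<^sub>R (P i ** \<Phi>) - \<sigma> *\<^sub>R \<Phi>" for i
  define G where "G i j = (1 / \<sigma>\<^sup>2) *\<^sub>R (adj \<Phi> ** P i ** P j ** \<Phi>)" for i j
  have QQ: "adj (Q i) ** Q j = G i j - \<sigma>\<^sup>2 *\<^sub>R mat 1" if "i \<in> {1..n-1}" "j \<in> {1..n-1}" for i j
  proof -
    have ij: "i \<in> {1..n}" "i \<noteq> n" "j \<in> {1..n}" "j \<noteq> n" using that n by auto
    have "adj (Q i) ** Q j = (1 / \<sigma>\<^sup>2) *\<^sub>R (adj \<Phi> ** P i ** P j ** \<Phi>)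
        - adj \<Phi> ** P i ** \<Phi> - adj \<Phi> ** P j ** \<Phi> + \<sigma>\<^sup>2 *\<^sub>R (adj \<Phi> ** \<Phi>)"
      using \<sigma>0 herm[OF ij(1)]
      by (simp add: Q_def adj_distribs matrix_distribs matrix_mul_assoc power2_eq_square algebra_simps)
    then show ?thesis by (simp add: comp[OF ij(1,2)] comp[OF ij(3,4)] \<Phi>(1) G_def)
  qed
  have Gii: "G i i = mat 1" if "i \<in> {1..n-1}" for i
  proof -
    have i: "i \<in> {1..n}" "i \<noteq> n" using that n by auto
    have "adj \<Phi> ** P i ** P i ** \<Phi> = adj \<Phi> ** (P i ** P i) ** \<Phi>" by (simp only: matrix_mul_assoc)
    then show ?thesis using \<sigma>0 by (simp add: G_def idem[OF i(1)] comp[OF i])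
  qed
  have GG: "G i j ** adj (G i j) = \<sigma>\<^sup>2 *\<^sub>R mat 1"
    if "i \<in> {1..n-1}" "j \<in> {1..n-1}" "i \<noteq> j" for i j
  proof -
    have ij: "i \<in> {1..n}" "i \<noteq> n" "j \<in> {1..n}" "j \<noteq> n" "n \<in> {1..n}" using that n by auto
    \<comment> \<open>Isoclinism is used for three pairs in turn: \<open>j\<close> with
      \<open>n\<close>, \<open>i\<close> with \<open>j\<close>, and \<open>n\<close> with
      \<open>i\<close>. This gives \<sigma>^6 / \<sigma>^4.\<close>
    have "G i j ** adj (G i j) =
        (1 / \<sigma> ^ 4) *\<^sub>R (adj \<Phi> ** P i ** (P j ** (\<Phi> ** adj \<Phi>) ** P j) ** P i ** \<Phi>)"
      using herm[OF ij(1)] herm[OF ij(3)] by (simp add: G_def adj_distribs matrix_distribs matrix_mul_assoc power4_eq_xxxx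
          power2_eq_square)
    also have "P j ** (\<Phi> ** adj \<Phi>) ** P j = \<sigma>\<^sup>2 *\<^sub>R P j"
      using iso[OF ij(3,5,4)] by (simp add: \<Phi>(2))
    also have "(1 / \<sigma> ^ 4) *\<^sub>R (adj \<Phi> ** P i ** (\<sigma>\<^sup>2 *\<^sub>R P j) ** P i ** \<Phi>) =
        (\<sigma>\<^sup>2 / \<sigma> ^ 4) *\<^sub>R (adj \<Phi> ** (P i ** P j ** P i) ** \<Phi>)"
      by (simp add: matrix_distribs matrix_mul_assoc)
    also have "\<dots> = (\<sigma>\<^sup>2 / \<sigma> ^ 4) *\<^sub>R \<sigma>\<^sup>2 *\<^sub>R \<sigma>\<^sup>2 *\<^sub>R mat 1"
      by (simp only: iso[OF ij(1,3) that(3)] matrix_distribs comp[OF ij(1,2)])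
    also have "\<dots> = \<sigma>\<^sup>2 *\<^sub>R mat 1"
    proof -
      have "\<sigma>\<^sup>2 / \<sigma> ^ 4 * (\<sigma>\<^sup>2 * \<sigma>\<^sup>2) = \<sigma>\<^sup>2"
        using \<sigma>0 by (simp add: power4_eq_xxxx power2_eq_square)
      then show ?thesis by (simp only: scaleR_scaleR mult.assoc)
    qed
    finally show ?thesis .
  qed
  have one: "1 \<in> {1..n-1}" using n by simp
  have \<Phi>Q: "adj \<Phi> ** Q i = 0" if "i \<in> {1..n-1}" for i
  proof -
    have "i \<in> {1..n}" "i \<noteq> n" using that n by auto
    then show ?thesis
      using comp[of i] \<sigma>0 by (simp add: Q_def matrix_distribs matrix_mul_assoc \<Phi>(1) power2_eq_square)
  qed
  have PQ: "P n ** Q i = 0" "adj (Q i) ** P n = 0" if "i \<in> {1..n-1}" for i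
  proof -
    have "P n ** Q i = \<Phi> ** (adj \<Phi> ** Q i)" by (simp add: \<Phi>(2) matrix_mul_assoc)
    then show 1: "P n ** Q i = 0" by (simp add: \<Phi>Q[OF that])
    have "adj (P n ** Q i) = adj (Q i) ** P n" using herm[of n] n by (simp add: adj_mult)
    then show "adj (Q i) ** P n = 0" by (simp add: 1)
  qed
  \<comment> \<open>Up to the factor \<open>sqrt \<beta>\<close>, \<open>Q 1\<close> serves as the
    isometry onto the complement of the last subspace. This choice makes \<open>B 1\<close> the
    identity.\<close>
  define S where "S = Q 1"
  have PS: "P n ** S = 0" "adj S ** P n = 0"
    using PQ[OF one] by (simp_all add: S_def)
  have SS: "adj S ** S = \<beta> *\<^sub>R mat 1"
    using QQ[OF one one] Gii[OF one] by (simp add: S_def \<beta>(1) scaleR_diff_left)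
  \<comment> \<open>The projection onto what the last subspace and the range of \<open>S\<close>
    leave over. Its trace is 2r - r - r = 0, so it vanishes; here the dimension being twice the rank
    is essential.\<close>
  define R where "R = mat 1 - P n - (1 / \<beta>) *\<^sub>R (S ** adj S)"
  have "R = 0"
  proof (rule adj_mult_self_eq_0)
    have n1: "n \<in> {1..n}" using n by simp
    have adjR: "adj R = R" using herm[OF n1] by (simp add: R_def adj_distribs)
    have "S ** adj S ** (S ** adj S) = S ** (adj S ** S) ** adj S"
      by (simp only: matrix_mul_assoc)
    then have q: "S ** adj S ** (S ** adj S) = \<beta> *\<^sub>R (S ** adj S)"
      by (simp only: SS matrix_distribs matrix_mul_rid)
    have z: "S ** adj S ** P n = 0" "P n ** (S ** adj S) = 0"
      using PS by (simp_all add: matrix_mul_assoc) (simp flip: matrix_mul_assoc)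
    have RR: "R ** R = R"
      using \<beta>(2) by (simp add: R_def matrix_distribs q z idem[OF n1] power2_eq_square)
    have "inner R R = re (trace R)"
      using re_trace_adj_mult[of R R] by (simp add: adjR RR)
    also have "\<dots> = real CARD('d) - re (trace (P n)) - (1 / \<beta>) * re (trace (S ** adj S))"
    proof -
      have "re (trace (mat 1 :: 'a^'d^'d)) =
          re (trace (R + (P n + (1 / \<beta>) *\<^sub>R (S ** adj S))))"
        by (simp add: R_def)
      then show ?thesis by (simp only: trace_add re_add trace_scaleR re_scaleR re_trace_mat_1)
    qed
    also have "trace (S ** adj S) = trace (\<beta> *\<^sub>R mat 1 :: 'a^'r^'r)"
      by (simp only: trace_mult_commute[of S] SS)
    finally have "inner R R = 0"
      using \<beta>(2) by (simp add: trP[OF n1] card trace_scaleR re_scaleR re_trace_mat_1)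
    then show "adj R ** R = 0" by simp
  qed
  then have SS': "S ** adj S = \<beta> *\<^sub>R (mat 1 - P n)"
    using \<beta>(2) by (simp add: R_def)
  \<comment> \<open>Coordinates with respect to \<open>S\<close>: since \<open>S ** adj S\<close> is
    \<beta> times the projection onto the complement, \<open>Q j = S ** B j\<close>.\<close>
  define B where "B j = (1 / \<beta>) *\<^sub>R (adj S ** Q j)" for j
  have BB: "adj (B i) ** B j = (1 / \<beta>) *\<^sub>R (G i j - \<sigma>\<^sup>2 *\<^sub>R mat 1)"
    if "i \<in> {1..n-1}" "j \<in> {1..n-1}" for i j
  proof -
    have "adj (B i) ** B j = (1 / \<beta>\<^sup>2) *\<^sub>R (adj (Q i) ** (S ** adj S) ** Q j)"
      by (simp add: B_def adj_distribs matrix_distribs matrix_mul_assoc power2_eq_square)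
    also have "\<dots> = (1 / \<beta>) *\<^sub>R (adj (Q i) ** Q j)"
      using \<beta>(2) PQ[OF that(1)] by (simp add: SS' matrix_distribs power2_eq_square)
    finally show ?thesis unfolding QQ[OF that] .
  qed
  have uni: "unitary (B i)" if "i \<in> {1..n-1}" for i
  proof (rule unitaryI)
    have "adj (B i) ** B i = (1 / \<beta> * (1 - \<sigma>\<^sup>2)) *\<^sub>R mat 1"
      by (simp add: BB[OF that that] Gii[OF that] scaleR_diff_left scaleR_diff_right algebra_simps)
    then show "adj (B i) ** B i = mat 1" using \<beta> by simp
  qed
  have "adj (B i) ** B j + adj (B j) ** B i = (- 2 / (real n - 2)) *\<^sub>R mat 1"
    if ij: "i \<in> {1..n-1}" "j \<in> {1..n-1}" "i \<noteq> j" for i j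
  proof -
    let ?X = "adj (B i) ** B j"
    have "?X ** adj ?X = adj (B i) ** (B j ** adj (B j)) ** B i"
      by (simp add: adj_mult matrix_mul_assoc)
    then have XX: "?X ** adj ?X = mat 1"
      using uni ij by (simp add: unitary_def)
    have GX: "G i j = \<sigma>\<^sup>2 *\<^sub>R mat 1 + \<beta> *\<^sub>R ?X"
      using \<beta>(2) by (simp add: BB[OF ij(1,2)])
    have "\<sigma>\<^sup>2 *\<^sub>R mat 1 = G i j ** adj (G i j)" by (simp add: GG[OF ij])
    also have "\<dots> = (\<sigma>\<^sup>2)\<^sup>2 *\<^sub>R mat 1 + \<beta>\<^sup>2 *\<^sub>R mat 1 + (\<sigma>\<^sup>2 * \<beta>) *\<^sub>R (?X + adj ?X)"
      by (simp only: GX adj_add adj_scaleR adj_mat_1 matrix_affine_gram XX)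
    finally have "(\<sigma>\<^sup>2 * \<beta>) *\<^sub>R (?X + adj ?X) = (\<sigma>\<^sup>2 - (\<sigma>\<^sup>2)\<^sup>2 - \<beta>\<^sup>2) *\<^sub>R mat 1"
      by (simp only: scaleR_diff_left) simp
    then have "(1 / (\<sigma>\<^sup>2 * \<beta>)) *\<^sub>R (\<sigma>\<^sup>2 * \<beta>) *\<^sub>R (?X + adj ?X) =
        (1 / (\<sigma>\<^sup>2 * \<beta>)) *\<^sub>R (\<sigma>\<^sup>2 - (\<sigma>\<^sup>2)\<^sup>2 - \<beta>\<^sup>2) *\<^sub>R mat 1"
      by (simp only:)
    then have "?X + adj ?X = ((\<sigma>\<^sup>2 - (\<sigma>\<^sup>2)\<^sup>2 - \<beta>\<^sup>2) / (\<sigma>\<^sup>2 * \<beta>)) *\<^sub>R mat 1"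
      using \<sigma>0 \<beta>(2) by simp
    also have "(\<sigma>\<^sup>2 - (\<sigma>\<^sup>2)\<^sup>2 - \<beta>\<^sup>2) / (\<sigma>\<^sup>2 * \<beta>) = - 2 / (real n - 2)"
    proof -
      \<comment> \<open>Because \<beta> = 1 - \<sigma>^2, the first two terms are \<sigma>^2
        \<beta>, so \<beta> factors out and cancels.\<close>
      have "\<sigma>\<^sup>2 - (\<sigma>\<^sup>2)\<^sup>2 - \<beta>\<^sup>2 = (2 * \<sigma>\<^sup>2 - 1) * \<beta>"
        unfolding \<beta>(1) by (simp add: algebra_simps power2_eq_square)
      then have "(\<sigma>\<^sup>2 - (\<sigma>\<^sup>2)\<^sup>2 - \<beta>\<^sup>2) / (\<sigma>\<^sup>2 * \<beta>) = (2 * \<sigma>\<^sup>2 - 1) / \<sigma>\<^sup>2"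
        using \<beta>(2) by simp
      also have "\<dots> = - 2 / (real n - 2)"
        unfolding \<sigma>2 using rn by (simp add: divide_simps)
      finally show ?thesis .
    qed
    finally show ?thesis by (simp add: adj_mult)
  qed
  then show ?thesis using uni by blast
qed

lemma eitff_iff_rho_orthonormal:
  assumes n: "n \<ge> 3" and card: "CARD('d::finite) = 2 * CARD('r::finite)"
  shows "(\<exists>U :: nat \<Rightarrow> ('a::real_or_complex^'d) set. eitff (CARD('r)) n U) \<longleftrightarrow>
    (\<exists>C :: nat \<Rightarrow> 'a^'r^'r. rho_orthonormal (n - 2) C)"
proof
  assume "\<exists>U :: nat \<Rightarrow> ('a^'d) set. eitff (CARD('r)) n U"
  then obtain U :: "nat \<Rightarrow> ('a^'d) set" where "eitff (CARD('r)) n U" by blast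
  from simplex_if_eitff[OF n card this] obtain B :: "nat \<Rightarrow> 'a^'r^'r"
    where "(\<forall>i\<in>{1..n-1}. unitary (B i)) \<and>
    (\<forall>i\<in>{1..n-1}. \<forall>j\<in>{1..n-1}. i \<noteq> j \<longrightarrow>
      adj (B i) ** B j + adj (B j) ** B i = (- 2 / (real n - 2)) *\<^sub>R mat 1)" by blast
  then show "\<exists>C :: nat \<Rightarrow> 'a^'r^'r. rho_orthonormal (n - 2) C"
    unfolding simplex_iff(1)[OF n] simplex_iff(2)[OF n] by blast
next
  assume "\<exists>C :: nat \<Rightarrow> 'a^'r^'r. rho_orthonormal (n - 2) C"
  then obtain C :: "nat \<Rightarrow> 'a^'r^'r" where C: "rho_orthonormal (n - 2) C" by blast
  define B where "B j = (\<Sum>i\<in>{1..n-2}. Psi (n - 1) i j *\<^sub>R C i)" for j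
  have "\<exists>S. rho_space S \<and> simplex_in S rho_inner (n - 1) B"
    unfolding simplex_iff(2)[OF n] using C by (auto simp: B_def)
  then obtain S where S: "rho_space S" "simplex_in S rho_inner (n - 1) B" by blast
  then have B: "(\<forall>i\<in>{1..n-1}. unitary (B i)) \<and>
    (\<forall>i\<in>{1..n-1}. \<forall>j\<in>{1..n-1}. i \<noteq> j \<longrightarrow>
      adj (B i) ** B j + adj (B j) ** B i = (- 2 / (real n - 2)) *\<^sub>R mat 1)"
    unfolding simplex_iff(1)[OF n] by blast
  have "(\<Sum>i=1..n-1. B i) = 0"
    by (rule sum_simplex_eq_0) (use S(2) n in \<open>auto simp: simplex_in_def\<close>)
  then show "\<exists>U :: nat \<Rightarrow> ('a^'d) set. eitff (CARD('r)) n U"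
    using eitff_if_simplex[OF n card, of B] B by blast
qed

theorem theorem3p2:
  fixes r n :: nat
  assumes "r \<ge> 1" and "n \<ge> 3"
    and "CARD('r::finite) = r" and "CARD('d::finite) = 2 * r"
  shows
    "(\<forall>B :: nat \<Rightarrow> real^'r^'r.
       (((\<forall>i\<in>{1..n-1}. unitary (B i)) \<and>
         (\<forall>i\<in>{1..n-1}. \<forall>j\<in>{1..n-1}. i \<noteq> j \<longrightarrow>
            adj (B i) ** B j + adj (B j) ** B i = (- 2 / (real n - 2)) *\<^sub>R mat 1))
        \<longleftrightarrow> (\<exists>S. rho_space S \<and> simplex_in S rho_inner (n - 1) B)) \<and>
       ((\<exists>S. rho_space S \<and> simplex_in S rho_inner (n - 1) B)
        \<longleftrightarrow> (\<exists>C. rho_orthonormal (n - 2) C \<and>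
              (\<forall>j\<in>{1..n-1}. B j = (\<Sum>i\<in>{1..n-2}. Psi (n - 1) i j *\<^sub>R C i)))))
     \<and>
     (\<forall>B :: nat \<Rightarrow> complex^'r^'r.
       (((\<forall>i\<in>{1..n-1}. unitary (B i)) \<and>
         (\<forall>i\<in>{1..n-1}. \<forall>j\<in>{1..n-1}. i \<noteq> j \<longrightarrow>
            adj (B i) ** B j + adj (B j) ** B i = (- 2 / (real n - 2)) *\<^sub>R mat 1))
        \<longleftrightarrow> (\<exists>S. rho_space S \<and> simplex_in S rho_inner (n - 1) B)) \<and>
       ((\<exists>S. rho_space S \<and> simplex_in S rho_inner (n - 1) B)
        \<longleftrightarrow> (\<exists>C. rho_orthonormal (n - 2) C \<and>
              (\<forall>j\<in>{1..n-1}. B j = (\<Sum>i\<in>{1..n-2}. Psi (n - 1) i j *\<^sub>R C i)))))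
     \<and>
     ((\<exists>U :: nat \<Rightarrow> (real^'d) set. eitff r n U)
       \<longleftrightarrow> n \<le> radon_hurwitz TYPE(real) TYPE('r) + 2)
     \<and>
     ((\<exists>U :: nat \<Rightarrow> (complex^'d) set. eitff r n U)
       \<longleftrightarrow> n \<le> radon_hurwitz TYPE(complex) TYPE('r) + 2)
     \<and>
     (\<forall>a b c. r = (2 * a + 1) * 2 ^ (4 * b + c) \<and> c \<le> 3
       \<longrightarrow> radon_hurwitz TYPE(real) TYPE('r) = 8 * b + 2 ^ c \<and>
           radon_hurwitz TYPE(complex) TYPE('r) = 8 * b + 2 * c + 2)"
proof -
  have n: "n - 2 \<le> m \<longleftrightarrow> n \<le> m + 2" for m by linarith
  have card: "CARD('d) = 2 * CARD('r)" using assms(3,4) by simp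
  have real: "(\<exists>U :: nat \<Rightarrow> (real^'d) set. eitff r n U) \<longleftrightarrow>
      n \<le> radon_hurwitz TYPE(real) TYPE('r) + 2"
    using eitff_iff_rho_orthonormal[OF assms(2) card, where 'a = real] assms(3)
    by (simp only: n[symmetric] le_radon_hurwitz_iff)
  have complex: "(\<exists>U :: nat \<Rightarrow> (complex^'d) set. eitff r n U) \<longleftrightarrow>
      n \<le> radon_hurwitz TYPE(complex) TYPE('r) + 2"
    using eitff_iff_rho_orthonormal[OF assms(2) card, where 'a = complex] assms(3)
    by (simp only: n[symmetric] le_radon_hurwitz_iff)
  have radon: "radon_hurwitz TYPE(real) TYPE('r) = 8 * b + 2 ^ c"
      "radon_hurwitz TYPE(complex) TYPE('r) = 8 * b + 2 * c + 2"
    if "r = (2 * a + 1) * 2 ^ (4 * b + c) \<and> c \<le> 3" for a b c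
  proof -
    have r: "CARD('r) = (2 * a + 1) * 2 ^ (4 * b + c)" "c \<le> 3"
      using that assms(3) by simp_all
    show "radon_hurwitz TYPE(real) TYPE('r) = 8 * b + 2 ^ c"
      by (rule radon_hurwitz_real[OF r])
    show "radon_hurwitz TYPE(complex) TYPE('r) = 8 * b + 2 * c + 2"
      using radon_hurwitz_complex[OF r(1)] by simp
  qed
  show ?thesis
    by (intro conjI allI impI;
        (rule simplex_iff[OF assms(2)] | rule real | rule complex | erule radon))
qed

end
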